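(* Let $S_1$ be the set of Gauss words isomorphic to one of ABACDCBD, ABCBDACD, ABCDCADB; let $S_2$ be the set of Gauss words isomorphic to one of ABCACDBD, ABCADBDC, ABCDBDAC; let $S_3$ be the set of Gauss words isomorphic to ABACBDCD; and let $S_4$ be the set of all other Gauss words of rank at most $4$ (including the empty word). Then two Gauss words of rank at most $4$ are homotopic if and only if they belong to the same set $S_i$; that is, the Gauss words of rank at most $4$ fall into exactly these four homotopy classes.
   Context: A Gauss word is a finite sequence of letters in which every letter that occurs appears exactly twice (the empty word is allowed). Its rank is the number of distinct letters in it. Two Gauss words are isomorphic if there is a bijection between their sets of letters which transforms the first word into the second. Homotopy moves, for arbitrary (possibly empty) words $x,y,z,t$ such that both sides are Gauss words: (H1) $xAAy\leftrightarrow xy$; (H2) $xAByBAz\leftrightarrow xyz$; (H3) $xAByACzBCt\leftrightarrow xBAyCAzCBt$. Homotopy is the equivalence relation on Gauss words generated by isomorphism and the moves H1–H3. *)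

theory Defs
  imports Main "HOL-Library.Infinite_Typeclass"
begin

definition gauss_word :: "'a list \<Rightarrow> bool" where
  "gauss_word w \<longleftrightarrow> (\<forall>a \<in> set w. count_list w a = 2)"

definition gauss_rank :: "'a list \<Rightarrow> nat" where
  "gauss_rank w = card (set w)"

text \<open>The two words may use different alphabets, so that a word can be compared with a
  literal such as \<open>''ABAB''\<close>, which is a list of characters.\<close>

definition word_isomorphic :: "'a list \<Rightarrow> 'b list \<Rightarrow> bool" where
  "word_isomorphic v w \<longleftrightarrow> (\<exists>f. bij_betw f (set v) (set w) \<and> map f v = w)"

text \<open>In the moves the letters \<open>A\<close>, \<open>B\<close>, \<open>C\<close> are not required to be distinct or absent
  from \<open>x\<close>, \<open>y\<close>, \<open>z\<close>, \<open>t\<close>: this is enforced by both sides being Gauss words.\<close>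

inductive homotopy_move :: "'a list \<Rightarrow> 'a list \<Rightarrow> bool" where
  H1: "gauss_word (x @ [A, A] @ y) \<Longrightarrow> gauss_word (x @ y) \<Longrightarrow>
    homotopy_move (x @ [A, A] @ y) (x @ y)"
| H2: "gauss_word (x @ [A, B] @ y @ [B, A] @ z) \<Longrightarrow> gauss_word (x @ y @ z) \<Longrightarrow>
    homotopy_move (x @ [A, B] @ y @ [B, A] @ z) (x @ y @ z)"
| H3: "gauss_word (x @ [A, B] @ y @ [A, C] @ z @ [B, C] @ t) \<Longrightarrow>
    gauss_word (x @ [B, A] @ y @ [C, A] @ z @ [C, B] @ t) \<Longrightarrow>
    homotopy_move (x @ [A, B] @ y @ [A, C] @ z @ [B, C] @ t)
                  (x @ [B, A] @ y @ [C, A] @ z @ [C, B] @ t)"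

text \<open>The equivalence relation generated by isomorphism and the moves. The alphabet is
  infinite, so that moves introducing fresh letters are always available.\<close>

inductive homotopic :: "'a::infinite list \<Rightarrow> 'a list \<Rightarrow> bool" where
  iso: "gauss_word v \<Longrightarrow> gauss_word w \<Longrightarrow> word_isomorphic v w \<Longrightarrow> homotopic v w"
| move: "homotopy_move v w \<Longrightarrow> homotopic v w"
| refl: "gauss_word w \<Longrightarrow> homotopic w w"
| sym: "homotopic v w \<Longrightarrow> homotopic w v"
| trans: "homotopic u v \<Longrightarrow> homotopic v w \<Longrightarrow> homotopic u w"

definition G4 :: "'a list set" where
  "G4 = {w. gauss_word w \<and> gauss_rank w \<le> 4}"

definition S1 :: "'a list set" where
  "S1 = {w. gauss_word w \<and>
    (word_isomorphic w ''ABACDCBD'' \<or> word_isomorphic w ''ABCBDACD'' \<or> word_isomorphic w ''ABCDCADB'')}"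

definition S2 :: "'a list set" where
  "S2 = {w. gauss_word w \<and>
    (word_isomorphic w ''ABCACDBD'' \<or> word_isomorphic w ''ABCADBDC'' \<or> word_isomorphic w ''ABCDBDAC'')}"

definition S3 :: "'a list set" where
  "S3 = {w. gauss_word w \<and> word_isomorphic w ''ABACBDCD''}"

definition S4 :: "'a list set" where
  "S4 = G4 - (S1 \<union> S2 \<union> S3)"

end

theory Submission
  imports Defs "HOL-Library.Z2"
begin

text \<open>The classes are separated by two invariants with values in \<open>\<int>/2\<close>. Call a letter odd if it is
  interlaced with an odd number of letters; the moves H1--H3 preserve this property. Each invariant
  counts, modulo 2, the sets of letters for which the restriction of the word, labelled by the
  parities of its letters, belongs to a fixed set of patterns. Compatibility of the patterns with
  the moves is a finite check. Conversely, after removing pairs \<open>AA\<close>, \<open>AB\<dots>BA\<close> and \<open>AB\<dots>AB\<close> (the last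
  one being a derived move), only twelve nonempty words of rank at most 4 remain: five are
  homotopic to reducible words by one move of type H3, and the others represent the sets
  \<open>S\<^sub>1\<close>, \<open>S\<^sub>2\<close>, \<open>S\<^sub>3\<close>.\<close>

text \<open>Why sums, and why modulo 2: split the sets of letters according to which letters of the
  move they contain. A letter removed by H1 is even, so its sets contribute nothing if no pattern
  contains an even \<open>AA\<close>; an odd \<open>AA\<close> is allowed, and the patterns used
  here rely on it. The two letters removed by H2 have equal parity, so sets containing exactly one
  of them come in pairs with equal contributions, which cancel only modulo 2. In H3 the parities of
  the three letters add up to zero, which leaves few labellings to check. Two bits have four values,
  just enough for four classes.

  Why parallel pairs: \<open>ABACBC\<close> becomes \<open>BACACB\<close> under H3, and the only
  pair to be removed there is the parallel \<open>AC\<close>, to which H2 does not apply.\<close>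

lemma gauss_word_iff: "gauss_word w \<longleftrightarrow> (\<forall>a. count_list w a = 0 \<or> count_list w a = 2)"
  by (metis count_list_0_iff gauss_word_def zero_neq_numeral)

subsection \<open>Counting patterns\<close>

primrec position_sum :: "'a list \<Rightarrow> 'a \<Rightarrow> nat" where
  "position_sum [] a = 0"
| "position_sum (b # w) a = position_sum w a + count_list w a"

lemma position_sum_append:
  "position_sum (v @ w) a = position_sum v a + length v * count_list w a + position_sum w a"
  by (induction v) (auto simp: algebra_simps)

lemma position_sum_notin [simp]: "a \<notin> set w \<Longrightarrow> position_sum w a = 0"
  by (induction w) (auto simp: count_list_0_iff)

lemma count_list_constant: "set w \<subseteq> {a} \<Longrightarrow> count_list w a = length w"
  by (induction w) auto

lemma count_list_filter: "count_list (filter Q w) a = (if Q a then count_list w a else 0)"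
  by (induction w) auto

lemma gauss_word_filter: "gauss_word w \<Longrightarrow> gauss_word (filter Q w)"
  by (auto simp: gauss_word_iff count_list_filter)

lemma count_list_map_inj_on:
  "inj_on f (insert a (set w)) \<Longrightarrow> count_list (map f w) (f a) = count_list w a"
  by (induction w) (auto simp: inj_on_def)

lemma position_sum_map:
  "inj_on f (insert a (set w)) \<Longrightarrow> position_sum (map f w) (f a) = position_sum w a"
  by (induction w) (auto simp: inj_on_def count_list_map_inj_on)

text \<open>Between its two occurrences a letter meets an odd number of letters exactly once if and only
  if the two positions have the same parity.\<close>

definition odd_letter :: "'a list \<Rightarrow> 'a \<Rightarrow> bool" where
  "odd_letter w a \<longleftrightarrow> even (position_sum w a)"

text \<open>The second components say which letters of \<open>u\<close> agree: a letter is encoded by the index of its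
  first occurrence.\<close>

definition labelled_pattern :: "('a \<Rightarrow> bool) \<Rightarrow> 'a list \<Rightarrow> (bool \<times> nat) list" where
  "labelled_pattern l u = map (\<lambda>a. (l a, length (takeWhile (\<lambda>b. b \<noteq> a) u))) u"

definition occurs :: "(bool \<times> nat) list set \<Rightarrow> ('a \<Rightarrow> bool) \<Rightarrow> 'a list \<Rightarrow> bit" where
  "occurs P l u = of_bool (labelled_pattern l u \<in> P)"

text \<open>The labels are parities in \<open>w\<close> itself, not in the restricted word: the
  restriction \<open>ABBA\<close> has no interlaced letters, yet its letters may be labelled
  odd.\<close>

definition pattern_count :: "(bool \<times> nat) list set \<Rightarrow> 'a list \<Rightarrow> bit" where
  "pattern_count P w =
    (\<Sum>T\<in>Pow (set w). occurs P (odd_letter w) (filter (\<lambda>a. a \<in> T) w))"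

section \<open>Dependence of pattern counts on letters and labels\<close>

lemma labelled_pattern_map:
  assumes "inj_on f (set u)"
  shows "labelled_pattern l (map f u) = labelled_pattern (l \<circ> f) u"
proof -
  have "takeWhile (\<lambda>b. b \<noteq> f a) (map f u) = map f (takeWhile (\<lambda>b. b \<noteq> a) u)" if "a \<in> set u" for a
    unfolding takeWhile_map using assms that
    by (intro arg_cong[where f="map f"] takeWhile_cong) (auto simp: inj_on_def)
  then show ?thesis
    by (simp add: labelled_pattern_def)
qed

lemma labelled_pattern_cong:
  "(\<And>a. a \<in> set u \<Longrightarrow> l a = l' a) \<Longrightarrow> labelled_pattern l u = labelled_pattern l' u"
  by (auto simp: labelled_pattern_def)

lemma occurs_cong: "(\<And>a. a \<in> set u \<Longrightarrow> l a = l' a) \<Longrightarrow> occurs P l u = occurs P l' u"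
  using labelled_pattern_cong[of u l l'] by (simp add: occurs_def)

lemma occurs_map: "inj_on f (set u) \<Longrightarrow> occurs P l (map f u) = occurs P (l \<circ> f) u"
  by (simp add: occurs_def labelled_pattern_map)

lemma labelled_pattern_nth:
  "i < length u \<Longrightarrow>
    labelled_pattern l u ! i = (l (u ! i), length (takeWhile (\<lambda>b. b \<noteq> u ! i) u))"
  by (simp add: labelled_pattern_def)

lemma length_labelled_pattern [simp]: "length (labelled_pattern l u) = length u"
  by (simp add: labelled_pattern_def)

lemma pattern_count_isomorphic:
  assumes "word_isomorphic v w"
  shows "pattern_count P v = pattern_count P w"
proof -
  obtain f where f: "bij_betw f (set v) (set w)" and w: "map f v = w"
    using assms by (auto simp: word_isomorphic_def)
  have inj: "inj_on f (set v)"
    using f by (simp add: bij_betw_def)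
  have "occurs P (odd_letter w) (filter (\<lambda>a. a \<in> f ` T) w) =
      occurs P (odd_letter v) (filter (\<lambda>a. a \<in> T) v)" if T: "T \<subseteq> set v" for T
  proof -
    have "filter (\<lambda>a. a \<in> f ` T) w = map f (filter (\<lambda>a. f a \<in> f ` T) v)"
      by (simp add: w[symmetric] filter_map comp_def)
    also have "filter (\<lambda>a. f a \<in> f ` T) v = filter (\<lambda>a. a \<in> T) v"
      using inj T by (intro filter_cong) (auto simp: inj_on_def)
    finally have eq: "filter (\<lambda>a. a \<in> f ` T) w = map f (filter (\<lambda>a. a \<in> T) v)" .
    have "odd_letter w (f a) = odd_letter v a" if "a \<in> set v" for a
      using position_sum_map[of f a v] inj that
      by (simp add: odd_letter_def w[symmetric] insert_absorb)
    then have "labelled_pattern (odd_letter w \<circ> f) (filter (\<lambda>a. a \<in> T) v) =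
        labelled_pattern (odd_letter v) (filter (\<lambda>a. a \<in> T) v)"
      by (intro labelled_pattern_cong) auto
    then show ?thesis
      using inj by (simp add: occurs_def eq labelled_pattern_map inj_on_subset)
  qed
  then show ?thesis
    unfolding pattern_count_def
    by (subst sum.reindex_bij_betw[OF bij_betw_Pow[OF f], symmetric]) simp
qed

text \<open>Applied once for each letter of a move, this reduces invariance to a comparison for a
  fixed set \<open>T\<close> of untouched letters.\<close>

lemma sum_Pow_insert:
  fixes g :: "'a set \<Rightarrow> 'b::comm_monoid_add"
  assumes "finite R" "a \<notin> R"
  shows "(\<Sum>T\<in>Pow (insert a R). g T) = (\<Sum>T\<in>Pow R. g T + g (insert a T))"
proof -
  have "inj_on (insert a) (Pow R)"
    using assms(2) by (intro inj_onI) (metis PowD insert_ident subsetD)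
  moreover have "Pow R \<inter> insert a ` Pow R = {}"
    using assms by auto
  ultimately show ?thesis
    using assms by (simp add: Pow_insert sum.union_disjoint sum.reindex sum.distrib)
qed

text \<open>Of the restrictions of a word before and after a move H3, only those to at least two of the
  letters \<open>A\<close>, \<open>B\<close>, \<open>C\<close> differ.\<close>

definition H3_balanced ::
    "(bool \<times> nat) list set \<Rightarrow> ('a \<Rightarrow> bool) \<Rightarrow> 'a \<Rightarrow> 'a \<Rightarrow> 'a \<Rightarrow> 'a list \<Rightarrow> 'a list \<Rightarrow> 'a list \<Rightarrow> 'a list \<Rightarrow> bool" where
  "H3_balanced P l A B C X Y Z T \<longleftrightarrow>
      occurs P l (X @ [A,B] @ Y @ [A] @ Z @ [B] @ T) + occurs P l (X @ [A] @ Y @ [A,C] @ Z @ [C] @ T)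
      + occurs P l (X @ [B] @ Y @ [C] @ Z @ [B,C] @ T) + occurs P l (X @ [A,B] @ Y @ [A,C] @ Z @ [B,C] @ T) =
      occurs P l (X @ [B,A] @ Y @ [A] @ Z @ [B] @ T) + occurs P l (X @ [A] @ Y @ [C,A] @ Z @ [C] @ T)
      + occurs P l (X @ [B] @ Y @ [C] @ Z @ [C,B] @ T) + occurs P l (X @ [B,A] @ Y @ [C,A] @ Z @ [C,B] @ T)"

text \<open>The letters of a move H3 satisfy \<open>l A = (l B \<noteq> l C)\<close>. As patterns have rank at most 3, it
  suffices to check H3 in the presence of at most one further letter, here called 3.\<close>

locale invariant_patterns =
  fixes P :: "(bool \<times> nat) list set"
  assumes no_H1: "\<And>p i. p \<in> P \<Longrightarrow> Suc i < length p \<Longrightarrow> p ! i = p ! Suc i \<Longrightarrow> fst (p ! i)"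
    and no_H2: "\<And>p i j. p \<in> P \<Longrightarrow> Suc i < j \<Longrightarrow> Suc j < length p \<Longrightarrow>
      p ! i = p ! Suc j \<Longrightarrow> p ! Suc i = p ! j \<Longrightarrow> fst (p ! i) \<noteq> fst (p ! j)"
    and short: "\<And>p. p \<in> P \<Longrightarrow> length p \<le> 6"
    and H3_local: "\<And>(l :: nat \<Rightarrow> bool) X Y Z T. l 0 = (l 1 \<noteq> l 2) \<Longrightarrow> X @ Y @ Z @ T \<in> {[], [3, 3]} \<Longrightarrow>
      H3_balanced P l 0 1 2 X Y Z T"
begin

section \<open>Invariance of pattern counts under H1, H2 and H3\<close>

lemma occurs_H1_zero:
  assumes "\<not> l A"
  shows "occurs P l (x @ [A, A] @ y) = 0"
proof -
  let ?p = "labelled_pattern l (x @ [A, A] @ y)"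
  have "?p ! length x = ?p ! Suc (length x)" "\<not> fst (?p ! length x)"
    using assms by (simp_all add: labelled_pattern_nth nth_append)
  then show ?thesis
    using no_H1[of ?p "length x"] by (auto simp: occurs_def)
qed

lemma occurs_H2_zero:
  assumes "l A = l B"
  shows "occurs P l (x @ [A, B] @ y @ [B, A] @ z) = 0"
proof -
  let ?u = "x @ [A, B] @ y @ [B, A] @ z"
  let ?p = "labelled_pattern l ?u"
  let ?i = "length x" and ?j = "length x + 2 + length y"
  have "?u ! ?i = A" "?u ! Suc ?i = B" "?u ! ?j = B" "?u ! Suc ?j = A"
    by (simp_all add: nth_append)
  then have "?p ! ?i = ?p ! Suc ?j" "?p ! Suc ?i = ?p ! ?j" "fst (?p ! ?i) = fst (?p ! ?j)"
    using assms by (simp_all add: labelled_pattern_nth)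
  then have "?p \<notin> P"
    using no_H2[of ?p ?i ?j] by auto
  then show ?thesis
    by (simp add: occurs_def)
qed

text \<open>Nothing is interlaced with \<open>A\<close>, so \<open>A\<close> is even and the sets
  containing it contribute 0 by \<open>occurs_H1_zero\<close>. Deleting \<open>AA\<close> shifts the
  letters behind it by two places, which keeps all other parities.\<close>

lemma pattern_count_H1:
  assumes "gauss_word (x @ [A, A] @ y)"
  shows "pattern_count P (x @ [A, A] @ y) = pattern_count P (x @ y)"
proof -
  let ?w = "x @ [A, A] @ y" and ?v = "x @ y"
  let ?l = "odd_letter ?w"
  have "count_list ?w A = 2"
    using assms by (simp add: gauss_word_def)
  then have A: "A \<notin> set x" "A \<notin> set y" "A \<notin> set ?v"
    by (auto simp: count_list_0_iff[symmetric])
  have lab: "?l a = odd_letter ?v a" if "a \<noteq> A" for a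
    using that by (simp add: odd_letter_def position_sum_append) blast
  have nA: "\<not> ?l A"
    using A by (simp add: odd_letter_def position_sum_append)
  have eq: "occurs P ?l (filter (\<lambda>a. a \<in> T) ?w)
      + occurs P ?l (filter (\<lambda>a. a \<in> insert A T) ?w)
      = occurs P (odd_letter ?v) (filter (\<lambda>a. a \<in> T) ?v)" if "T \<subseteq> set ?v" for T
  proof -
    have "A \<notin> T"
      using that A by auto
    then have "occurs P ?l (filter (\<lambda>a. a \<in> T) ?w)
        = occurs P (odd_letter ?v) (filter (\<lambda>a. a \<in> T) ?v)"
      by (simp del: append.simps(2)) (intro occurs_cong lab; auto)
    moreover have "occurs P ?l (filter (\<lambda>a. a \<in> insert A T) ?w) = 0"
      using occurs_H1_zero[of ?l A, OF nA] by simp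
    ultimately show ?thesis
      by (simp only: add_0_right)
  qed
  have w: "set ?w = insert A (set ?v)"
    by auto
  show ?thesis
    unfolding pattern_count_def w sum_Pow_insert[OF finite_set A(3)]
    by (rule sum.cong; (rule eq)?; simp only: Pow_iff)
qed

text \<open>For each \<open>T\<close>, the sets with exactly one of \<open>A\<close>,
  \<open>B\<close> cancel, the set with both contributes 0 by \<open>occurs_H2_zero\<close>, and
  \<open>T\<close> itself gives the term of the shorter word.\<close>

lemma pattern_count_H2:
  assumes "gauss_word (x @ [A, B] @ y @ [B, A] @ z)"
  shows "pattern_count P (x @ [A, B] @ y @ [B, A] @ z) = pattern_count P (x @ y @ z)"
proof -
  let ?w = "x @ [A, B] @ y @ [B, A] @ z" and ?v = "x @ y @ z"
  let ?l = "odd_letter ?w"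
  have "count_list ?w A = 2" "count_list ?w B = 2"
    using assms unfolding gauss_word_def by simp_all
  then have AB: "A \<noteq> B" "A \<notin> set ?v" "B \<notin> set ?v"
    by (auto simp: count_list_0_iff[symmetric] split: if_splits)
  have lab: "?l a = odd_letter ?v a" if "a \<noteq> A" "a \<noteq> B" for a
  proof -
    have "position_sum ?w a = position_sum ?v a + 2 * (count_list y a + 2 * count_list z a)"
      using that by (simp add: position_sum_append algebra_simps)
    then show ?thesis
      by (simp add: odd_letter_def)
  qed
  \<comment> \<open>The two letters are mirror images of each other, so their position sums are
    equal.\<close>
  have lAB: "?l A = ?l B"
    using AB by (simp add: odd_letter_def position_sum_append)
  let ?g = "\<lambda>T. occurs P ?l (filter (\<lambda>a. a \<in> T) ?w)"
  have eq: "?g T + ?g (insert A T) + (?g (insert B T) + ?g (insert A (insert B T)))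
      = occurs P (odd_letter ?v) (filter (\<lambda>a. a \<in> T) ?v)" if "T \<subseteq> set ?v" for T
  proof -
    let ?f = "filter (\<lambda>a. a \<in> T)"
    have T: "A \<notin> T" "B \<notin> T"
      using that AB by auto
    have "?g T = occurs P (odd_letter ?v) (?f ?v)"
      using T by (simp del: append.simps(2)) (intro occurs_cong lab; auto)
    moreover have "?g (insert A (insert B T)) = 0"
      using occurs_H2_zero[of ?l A B, OF lAB] by simp
    moreover have "?g (insert A T) = ?g (insert B T)"
    proof -
      have f: "filter (\<lambda>a. a = C \<or> a \<in> T) u = ?f u" if "C \<in> {A, B}" "u \<in> {x, y, z}" for C u
        using that AB by (auto intro!: filter_cong)
      \<comment> \<open>Keeping only \<open>A\<close> or only \<open>B\<close> gives the same word
        up to this renaming, and the labels of \<open>A\<close> and \<open>B\<close> agree.\<close>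
      let ?r = "(\<lambda>a. a)(A := B)"
      have r: "map ?r (?f u) = ?f u" for u
        using T by (auto intro!: map_idI)
      have "filter (\<lambda>a. a \<in> insert B T) ?w = map ?r (filter (\<lambda>a. a \<in> insert A T) ?w)"
        using T AB by (simp add: f r)
      moreover have "inj_on ?r (insert A T)"
        using T by (auto simp: inj_on_def)
      then have "inj_on ?r (set (filter (\<lambda>a. a \<in> insert A T) ?w))"
        by (rule inj_on_subset) auto
      moreover have "?l \<circ> ?r = ?l"
      proof
        fix a
        show "(?l \<circ> ?r) a = ?l a"
          using lAB by (cases "a = A") simp_all
      qed
      ultimately show ?thesis
        by (simp only: occurs_map)
    qed
    moreover have "a + b + (b + 0) = a" for a b :: bit
      by (cases a; cases b) simp_all
    ultimately show ?thesis
      by (simp only:)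
  qed
  have w: "set ?w = insert A (insert B (set ?v))"
    by auto
  have "B \<notin> set ?v" "A \<notin> insert B (set ?v)"
    using AB by auto
  then have sum: "(\<Sum>T\<in>Pow (insert A (insert B (set ?v))). g T) =
      (\<Sum>T\<in>Pow (set ?v). g T + g (insert A T) + (g (insert B T) + g (insert A (insert B T))))"
    for g :: "'a set \<Rightarrow> bit"
    by (simp only: sum_Pow_insert finite_insert finite_set not_False_eq_True)
  show ?thesis
    unfolding pattern_count_def w sum by (rule sum.cong; (rule eq)?; simp only: Pow_iff)
qed

lemma occurs_long: "length u > 6 \<Longrightarrow> occurs P l u = 0"
  using short by (fastforce simp: occurs_def)

text \<open>Each summand has at least four entries from \<open>A\<close>, \<open>B\<close>,
  \<open>C\<close>. With more than two entries around them all summands vanish by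
  \<open>short\<close>; otherwise the surroundings are empty or consist of one letter
  \<open>D\<close>, and renaming to 0, 1, 2, 3 leads to \<open>H3_local\<close>.\<close>

lemma occurs_H3:
  assumes gauss: "gauss_word (X @ Y @ Z @ T)"
    and ABC: "A \<noteq> B" "A \<noteq> C" "B \<noteq> C" "A \<notin> set (X @ Y @ Z @ T)" "B \<notin> set (X @ Y @ Z @ T)" "C \<notin> set (X @ Y @ Z @ T)"
    and l: "l A = (l B \<noteq> l C)"
  shows "H3_balanced P l A B C X Y Z T"
proof (cases "length (X @ Y @ Z @ T) \<le> 2")
  case False
  then have "occurs P l u = 0" if "length u \<ge> length (X @ Y @ Z @ T) + 4" for u
    using that by (intro occurs_long) simp
  then show ?thesis
    by (simp add: H3_balanced_def)
next
  case True
  have "\<exists>D. D \<notin> {A, B, C} \<and> set (X @ Y @ Z @ T) \<subseteq> {D} \<or> X @ Y @ Z @ T = []"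
  proof (cases "X @ Y @ Z @ T")
    case (Cons D u)
    then have "count_list u D = 1"
      using gauss by (auto simp: gauss_word_def)
    then have "set u \<subseteq> {D}"
      using True Cons by (cases u) (auto split: if_splits simp: length_Suc_conv le_Suc_eq)
    then have "set (X @ Y @ Z @ T) \<subseteq> {D}"
      unfolding Cons by simp
    moreover have "D \<in> set (X @ Y @ Z @ T)"
      unfolding Cons by simp
    ultimately have "D \<notin> {A, B, C} \<and> set (X @ Y @ Z @ T) \<subseteq> {D}"
      using ABC by blast
    then show ?thesis
      by blast
  qed simp
  then obtain D where D: "set (X @ Y @ Z @ T) \<subseteq> {D}" "X @ Y @ Z @ T = [] \<or> D \<notin> {A, B, C}"
    by auto
  let ?f = "(!) [A, B, C, D]"
  have len: "length X + length Y + length Z + length T = 0 \<or> length X + length Y + length Z + length T = 2"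
  proof -
    have "count_list (X @ Y @ Z @ T) D = length (X @ Y @ Z @ T)"
      using D(1) by (rule count_list_constant)
    then show ?thesis
      using gauss unfolding gauss_word_iff by (metis length_append add.assoc)
  qed
  have rep: "X = map ?f (replicate (length X) 3)" "Y = map ?f (replicate (length Y) 3)"
    "Z = map ?f (replicate (length Z) 3)" "T = map ?f (replicate (length T) 3)"
    using D(1) by (simp_all add: subset_iff replicate_length_same)
  \<comment> \<open>If the surroundings are empty, \<open>D\<close> is arbitrary and may equal
    \<open>A\<close>, \<open>B\<close> or \<open>C\<close>; injectivity of \<open>?f\<close> at 3 is
    therefore demanded only in the other case.\<close>
  have occ: "occurs P l u = occurs P (l \<circ> ?f) u'"
    if "u = map ?f u'" "set u' \<subseteq> {0,1,2} \<union> (if X @ Y @ Z @ T = [] then {} else {3})" for u u'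
  proof -
    have "inj_on ?f ({0,1,2} \<union> (if X @ Y @ Z @ T = [] then {} else {3}))"
      using ABC D(2) by (auto simp: inj_on_def)
    then show ?thesis
      unfolding that(1) by (intro occurs_map) (use that(2) inj_on_subset in blast)
  qed
  let ?X = "replicate (length X) (3 :: nat)" and ?Y = "replicate (length Y) (3 :: nat)"
    and ?Z = "replicate (length Z) (3 :: nat)" and ?T = "replicate (length T) (3 :: nat)"
  have "?X @ ?Y @ ?Z @ ?T \<in> {[], [3, 3]}"
    using len by (auto simp: replicate_add[symmetric] add.assoc numeral_2_eq_2)
  then have "occurs P (l \<circ> ?f) (?X @ [0,1] @ ?Y @ [0] @ ?Z @ [1] @ ?T) + occurs P (l \<circ> ?f) (?X @ [0] @ ?Y @ [0,2] @ ?Z @ [2] @ ?T)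
      + occurs P (l \<circ> ?f) (?X @ [1] @ ?Y @ [2] @ ?Z @ [1,2] @ ?T) + occurs P (l \<circ> ?f) (?X @ [0,1] @ ?Y @ [0,2] @ ?Z @ [1,2] @ ?T) =
      occurs P (l \<circ> ?f) (?X @ [1,0] @ ?Y @ [0] @ ?Z @ [1] @ ?T) + occurs P (l \<circ> ?f) (?X @ [0] @ ?Y @ [2,0] @ ?Z @ [2] @ ?T)
      + occurs P (l \<circ> ?f) (?X @ [1] @ ?Y @ [2] @ ?Z @ [2,1] @ ?T) + occurs P (l \<circ> ?f) (?X @ [1,0] @ ?Y @ [2,0] @ ?Z @ [2,1] @ ?T)"
    using l by (intro H3_local[unfolded H3_balanced_def]) simp_all
  moreover have
    "occurs P l (X @ [A,B] @ Y @ [A] @ Z @ [B] @ T) = occurs P (l \<circ> ?f) (?X @ [0,1] @ ?Y @ [0] @ ?Z @ [1] @ ?T)"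
    "occurs P l (X @ [A] @ Y @ [A,C] @ Z @ [C] @ T) = occurs P (l \<circ> ?f) (?X @ [0] @ ?Y @ [0,2] @ ?Z @ [2] @ ?T)"
    "occurs P l (X @ [B] @ Y @ [C] @ Z @ [B,C] @ T) = occurs P (l \<circ> ?f) (?X @ [1] @ ?Y @ [2] @ ?Z @ [1,2] @ ?T)"
    "occurs P l (X @ [A,B] @ Y @ [A,C] @ Z @ [B,C] @ T) = occurs P (l \<circ> ?f) (?X @ [0,1] @ ?Y @ [0,2] @ ?Z @ [1,2] @ ?T)"
    "occurs P l (X @ [B,A] @ Y @ [A] @ Z @ [B] @ T) = occurs P (l \<circ> ?f) (?X @ [1,0] @ ?Y @ [0] @ ?Z @ [1] @ ?T)"
    "occurs P l (X @ [A] @ Y @ [C,A] @ Z @ [C] @ T) = occurs P (l \<circ> ?f) (?X @ [0] @ ?Y @ [2,0] @ ?Z @ [2] @ ?T)"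
    "occurs P l (X @ [B] @ Y @ [C] @ Z @ [C,B] @ T) = occurs P (l \<circ> ?f) (?X @ [1] @ ?Y @ [2] @ ?Z @ [2,1] @ ?T)"
    "occurs P l (X @ [B,A] @ Y @ [C,A] @ Z @ [C,B] @ T) = occurs P (l \<circ> ?f) (?X @ [1,0] @ ?Y @ [2,0] @ ?Z @ [2,1] @ ?T)"
    by (rule occ; use rep in \<open>auto simp: set_replicate_conv_if\<close>)+
  ultimately show ?thesis
    by (simp only: H3_balanced_def)
qed

text \<open>Restrictions to at most one of \<open>A\<close>, \<open>B\<close>, \<open>C\<close> do
  not change under the move; the sum of the four others is preserved by
  \<open>occurs_H3\<close>.\<close>

lemma pattern_count_H3:
  assumes "gauss_word (x @ [A, B] @ y @ [A, C] @ z @ [B, C] @ t)"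
  shows "pattern_count P (x @ [A, B] @ y @ [A, C] @ z @ [B, C] @ t) =
    pattern_count P (x @ [B, A] @ y @ [C, A] @ z @ [C, B] @ t)"
proof -
  let ?w = "x @ [A, B] @ y @ [A, C] @ z @ [B, C] @ t"
  let ?w' = "x @ [B, A] @ y @ [C, A] @ z @ [C, B] @ t"
  let ?v = "x @ y @ z @ t"
  let ?l = "odd_letter ?w"
  have "count_list ?w A = 2" "count_list ?w B = 2" "count_list ?w C = 2"
    using assms unfolding gauss_word_def by simp_all
  then have ABC: "A \<noteq> B" "A \<noteq> C" "B \<noteq> C" "A \<notin> set ?v" "B \<notin> set ?v" "C \<notin> set ?v"
    by (auto simp: count_list_0_iff[symmetric] split: if_splits)
  have "gauss_word ?v"
    unfolding gauss_word_iff
  proof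
    fix a
    show "count_list ?v a = 0 \<or> count_list ?v a = 2"
      using assms[unfolded gauss_word_iff, rule_format, of a] ABC
      by (cases "a \<in> {A, B, C}") (auto simp: count_list_0_iff)
  qed
  \<comment> \<open>The position sum of \<open>A\<close> grows by 2, that of \<open>B\<close> stays
    the same and that of \<open>C\<close> drops by 2.\<close>
  have lab: "odd_letter ?w' = ?l"
  proof
    fix a
    consider "a = A" | "a = B" | "a = C" | "a \<notin> {A, B, C}"
      by blast
    then show "odd_letter ?w' a = ?l a"
      by cases (use ABC in \<open>auto simp: odd_letter_def position_sum_append\<close>)
  qed
  \<comment> \<open>The six positions form three pairs of neighbours, so their total is odd. Since a
    letter is odd when its position sum is even, the number of odd letters among \<open>A\<close>,
    \<open>B\<close>, \<open>C\<close> is even.\<close>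
  have l: "?l A = (?l B \<noteq> ?l C)"
    using ABC by (auto simp: odd_letter_def position_sum_append)
  let ?g = "\<lambda>T. occurs P ?l (filter (\<lambda>a. a \<in> T) ?w)"
  let ?g' = "\<lambda>T. occurs P ?l (filter (\<lambda>a. a \<in> T) ?w')"
  let ?s = "\<lambda>g T. g T + g (insert A T) + (g (insert B T) + g (insert A (insert B T))) +
      (g (insert C T) + g (insert A (insert C T)) + (g (insert B (insert C T)) + g (insert A (insert B (insert C T)))))"
  have eq: "?s ?g T = ?s ?g' T" if "T \<subseteq> set ?v" for T
  proof -
    let ?f = "filter (\<lambda>a. a \<in> T)"
    have T: "A \<notin> T" "B \<notin> T" "C \<notin> T"
      using that ABC by auto
    have f: "filter (\<lambda>a. a \<in> U \<union> T) x = ?f x" "filter (\<lambda>a. a \<in> U \<union> T) y = ?f y"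
      "filter (\<lambda>a. a \<in> U \<union> T) z = ?f z" "filter (\<lambda>a. a \<in> U \<union> T) t = ?f t" if "U \<subseteq> {A, B, C}" for U
      using that ABC by (auto intro!: filter_cong)
    have gf: "gauss_word (?f x @ ?f y @ ?f z @ ?f t)"
      using gauss_word_filter[OF \<open>gauss_word ?v\<close>] by simp
    have fT: "A \<notin> set (?f x @ ?f y @ ?f z @ ?f t)" "B \<notin> set (?f x @ ?f y @ ?f z @ ?f t)"
      "C \<notin> set (?f x @ ?f y @ ?f z @ ?f t)"
      using T by auto
    note H3 = occurs_H3[of _ _ _ _ _ _ _ ?l, OF gf ABC(1-3) fT l, unfolded H3_balanced_def]
    let ?h = "\<lambda>U. filter (\<lambda>a. a \<in> U)"
    have w: "filter (\<lambda>a. a \<in> U \<union> T) ?w = ?f x @ ?h U [A, B] @ ?f y @ ?h U [A, C] @ ?f z @ ?h U [B, C] @ ?f t"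
      and w': "filter (\<lambda>a. a \<in> U \<union> T) ?w' = ?f x @ ?h U [B, A] @ ?f y @ ?h U [C, A] @ ?f z @ ?h U [C, B] @ ?f t"
      if "U \<subseteq> {A, B, C}" for U
      using f[OF that] T by simp_all
    \<comment> \<open>\<open>?s\<close> has the order produced by \<open>sum_Pow_insert\<close>;
      \<open>?r\<close> regroups its eight terms by whether they contain at most one or at least two
      of \<open>A\<close>, \<open>B\<close>, \<open>C\<close>.\<close>
    let ?r = "\<lambda>g. (g T + g (insert C T) + g (insert B T) + g (insert A T)) +
        (g (insert A (insert B T)) + g (insert A (insert C T)) + g (insert B (insert C T))
          + g (insert A (insert B (insert C T))))"
    have s: "?s g T = ?r g" for g :: "'a set \<Rightarrow> bit"
      by (simp only: ac_simps)
    have single: "?g T = ?g' T" "?g (insert C T) = ?g' (insert C T)" "?g (insert B T) = ?g' (insert B T)"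
        "?g (insert A T) = ?g' (insert A T)"
      using ABC w[of "{}"] w[of "{A}"] w[of "{B}"] w[of "{C}"] w'[of "{}"] w'[of "{A}"] w'[of "{B}"] w'[of "{C}"]
      by (simp_all del: filter_append)
    have multi: "?g (insert A (insert B T)) = occurs P ?l (?f x @ [A,B] @ ?f y @ [A] @ ?f z @ [B] @ ?f t)"
        "?g (insert A (insert C T)) = occurs P ?l (?f x @ [A] @ ?f y @ [A,C] @ ?f z @ [C] @ ?f t)"
        "?g (insert B (insert C T)) = occurs P ?l (?f x @ [B] @ ?f y @ [C] @ ?f z @ [B,C] @ ?f t)"
        "?g (insert A (insert B (insert C T))) = occurs P ?l (?f x @ [A,B] @ ?f y @ [A,C] @ ?f z @ [B,C] @ ?f t)"
        "?g' (insert A (insert B T)) = occurs P ?l (?f x @ [B,A] @ ?f y @ [A] @ ?f z @ [B] @ ?f t)"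
        "?g' (insert A (insert C T)) = occurs P ?l (?f x @ [A] @ ?f y @ [C,A] @ ?f z @ [C] @ ?f t)"
        "?g' (insert B (insert C T)) = occurs P ?l (?f x @ [B] @ ?f y @ [C] @ ?f z @ [C,B] @ ?f t)"
        "?g' (insert A (insert B (insert C T))) = occurs P ?l (?f x @ [B,A] @ ?f y @ [C,A] @ ?f z @ [C,B] @ ?f t)"
      using ABC w[of "{A, B}"] w[of "{A, C}"] w[of "{B, C}"] w[of "{A, B, C}"]
        w'[of "{A, B}"] w'[of "{A, C}"] w'[of "{B, C}"] w'[of "{A, B, C}"]
      by (simp_all del: filter_append)
    have "?r ?g = ?r ?g'"
      by (simp only: single multi H3)
    then show ?thesis
      by (simp only: s[of ?g] s[of ?g'])
  qed
  have w: "set ?w = insert A (insert B (insert C (set ?v)))"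
    and w': "set ?w' = insert A (insert B (insert C (set ?v)))"
    by auto
  have "C \<notin> set ?v" "B \<notin> insert C (set ?v)" "A \<notin> insert B (insert C (set ?v))"
    using ABC by auto
  then have sum: "(\<Sum>T\<in>Pow (insert A (insert B (insert C (set ?v)))). g T) = (\<Sum>T\<in>Pow (set ?v). ?s g T)"
    for g :: "'a set \<Rightarrow> bit"
    by (simp only: sum_Pow_insert finite_insert finite_set not_False_eq_True)
  show ?thesis
    unfolding pattern_count_def lab w w' sum by (rule sum.cong; (rule eq)?; simp only: Pow_iff)
qed

end

subsection \<open>The invariant\<close>

text \<open>\<open>True\<close> marks an odd letter. The two pattern sets were found by solving the linear system over
  \<open>\<int>/2\<close> that expresses invariance of a set of labelled words of rank at most 3.\<close>

definition nested_pattern :: "(bool \<times> nat) list set" where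
  "nested_pattern = {[(False, 0), (True, 1), (True, 1), (False, 0)]}"

definition triple_patterns :: "(bool \<times> nat) list set" where
  "triple_patterns = {
    [(False, 0), (True, 1), (False, 0), (True, 3), (True, 1), (True, 3)],
    [(True, 0), (False, 1), (True, 2), (False, 1), (True, 2), (True, 0)],
    [(False, 0), (False, 1), (False, 0), (True, 3), (False, 1), (True, 3)],
    [(True, 0), (True, 1), (True, 1), (True, 3), (True, 3), (True, 0)],
    [(True, 0), (False, 1), (True, 2), (True, 2), (False, 1), (True, 0)]}"

text \<open>Makes \<open>H3_local\<close> a finite check: the further letter is absent, has both
  occurrences in one of the four gaps, or lies in two of them. For each of these eleven placements
  there are eight labellings, as \<open>l 0\<close> is determined by \<open>l 1\<close> and
  \<open>l 2\<close>.\<close>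

lemma append4_eq_pair:
  assumes "X @ Y @ Z @ T \<in> {[], [a, a]}"
  shows "(X, Y, Z, T) \<in> {([],[],[],[]), ([a,a],[],[],[]), ([],[a,a],[],[]), ([],[],[a,a],[]), ([],[],[],[a,a]),
    ([a],[a],[],[]), ([a],[],[a],[]), ([a],[],[],[a]), ([],[a],[a],[]), ([],[a],[],[a]), ([],[],[a],[a])}"
  using assms by (simp add: append_eq_Cons_conv, elim disjE exE conjE) simp_all

interpretation nested: invariant_patterns nested_pattern
proof
  have "\<forall>p\<in>nested_pattern. \<forall>i<length p. Suc i < length p \<longrightarrow> p ! i = p ! Suc i \<longrightarrow> fst (p ! i)"
    by (simp add: nested_pattern_def numeral_eq_Suc All_less_Suc)
  then show "fst (p ! i)" if "p \<in> nested_pattern" "Suc i < length p" "p ! i = p ! Suc i" for p i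
    using that Suc_lessD by blast
next
  have "\<forall>p\<in>nested_pattern. \<forall>j<length p. \<forall>i<j. Suc i < j \<longrightarrow> Suc j < length p \<longrightarrow>
      p ! i = p ! Suc j \<longrightarrow> p ! Suc i = p ! j \<longrightarrow> fst (p ! i) \<noteq> fst (p ! j)"
    by (simp add: nested_pattern_def numeral_eq_Suc All_less_Suc)
  then show "fst (p ! i) \<noteq> fst (p ! j)" if "p \<in> nested_pattern" "Suc i < j" "Suc j < length p"
    "p ! i = p ! Suc j" "p ! Suc i = p ! j" for p i j
    using that Suc_lessD by blast
next
  show "length p \<le> 6" if "p \<in> nested_pattern" for p
    using that by (auto simp: nested_pattern_def)
next
  fix l :: "nat \<Rightarrow> bool" and X Y Z T :: "nat list"
  assume l: "l 0 = (l 1 \<noteq> l 2)" and "X @ Y @ Z @ T \<in> {[], [3, 3]}"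
  note append4_eq_pair[OF this(2)]
  then show "H3_balanced nested_pattern l 0 1 2 X Y Z T"
    using l
    by (elim insertE emptyE Pair_inject; hypsubst; cases "l 1"; cases "l 2"; cases "l 3";
      simp add: occurs_def labelled_pattern_def nested_pattern_def H3_balanced_def)
qed

interpretation triple: invariant_patterns triple_patterns
proof
  have "\<forall>p\<in>triple_patterns. \<forall>i<length p. Suc i < length p \<longrightarrow> p ! i = p ! Suc i \<longrightarrow> fst (p ! i)"
    by (simp add: triple_patterns_def numeral_eq_Suc All_less_Suc)
  then show "fst (p ! i)" if "p \<in> triple_patterns" "Suc i < length p" "p ! i = p ! Suc i" for p i
    using that Suc_lessD by blast
next
  have "\<forall>p\<in>triple_patterns. \<forall>j<length p. \<forall>i<j. Suc i < j \<longrightarrow> Suc j < length p \<longrightarrow>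
      p ! i = p ! Suc j \<longrightarrow> p ! Suc i = p ! j \<longrightarrow> fst (p ! i) \<noteq> fst (p ! j)"
    by (simp add: triple_patterns_def numeral_eq_Suc All_less_Suc)
  then show "fst (p ! i) \<noteq> fst (p ! j)" if "p \<in> triple_patterns" "Suc i < j" "Suc j < length p"
    "p ! i = p ! Suc j" "p ! Suc i = p ! j" for p i j
    using that Suc_lessD by blast
next
  show "length p \<le> 6" if "p \<in> triple_patterns" for p
    using that by (auto simp: triple_patterns_def)
next
  fix l :: "nat \<Rightarrow> bool" and X Y Z T :: "nat list"
  assume l: "l 0 = (l 1 \<noteq> l 2)" and "X @ Y @ Z @ T \<in> {[], [3, 3]}"
  note append4_eq_pair[OF this(2)]
  then show "H3_balanced triple_patterns l 0 1 2 X Y Z T"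
    using l
    by (elim insertE emptyE Pair_inject; hypsubst; cases "l 1"; cases "l 2"; cases "l 3";
      simp add: occurs_def labelled_pattern_def triple_patterns_def H3_balanced_def)
qed

text \<open>The values on \<open>S1\<close>, \<open>S2\<close>, \<open>S3\<close>, \<open>S4\<close>
  will be (1, 0), (1, 1), (0, 1), (0, 0).\<close>

definition word_invariant :: "'a list \<Rightarrow> bit \<times> bit" where
  "word_invariant w = (pattern_count nested_pattern w, pattern_count triple_patterns w)"

lemma word_invariant_isomorphic:
  "word_isomorphic v w \<Longrightarrow> word_invariant v = word_invariant w"
  by (simp add: word_invariant_def pattern_count_isomorphic)

lemma word_invariant_homotopic:
  "homotopic v w \<Longrightarrow> word_invariant v = word_invariant w"
proof (induction rule: homotopic.induct)
  case (iso v w)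
  show ?case
    using iso(3) by (rule word_invariant_isomorphic)
next
  case (move v w)
  then show ?case
  proof cases
    case H1
    then show ?thesis
      by (simp only: word_invariant_def nested.pattern_count_H1 triple.pattern_count_H1)
  next
    case H2
    then show ?thesis
      by (simp only: word_invariant_def nested.pattern_count_H2 triple.pattern_count_H2)
  next
    case (H3 x A B y C z t)
    then show ?thesis
      by (simp only: word_invariant_def nested.pattern_count_H3[OF H3(3)] triple.pattern_count_H3[OF H3(3)])
  qed
qed simp_all

subsection \<open>Derived moves\<close>

lemma word_isomorphicI: "inj_on f (set v) \<Longrightarrow> map f v = w \<Longrightarrow> word_isomorphic v w"
  unfolding word_isomorphic_def by (metis bij_betw_imageI list.set_map)

lemma fresh_letter:
  fixes F :: "'a::infinite set"
  assumes "finite F"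
  obtains P where "P \<notin> F"
  using ex_new_if_finite[OF infinite_UNIV assms] by blast

text \<open>Serves to check the intermediate words of a chain of moves: only the letters that the
  moves touch have to be counted.\<close>

lemma gauss_word_transfer:
  assumes "gauss_word v" "\<And>a. a \<notin> F \<Longrightarrow> count_list w a = count_list v a"
    and "\<forall>a\<in>F. count_list w a \<in> {0, 2}"
  shows "gauss_word w"
  unfolding gauss_word_iff
proof
  fix a
  show "count_list w a = 0 \<or> count_list w a = 2"
    using assms unfolding gauss_word_iff by (cases "a \<in> F") auto
qed

lemma gauss_word_parallel_pairs:
  assumes "gauss_word (x @ [A, B] @ y @ [A, B] @ z)"
  shows "A \<noteq> B \<and> A \<notin> set (x @ y @ z) \<and> B \<notin> set (x @ y @ z) \<and> gauss_word (x @ y @ z)"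
proof -
  let ?w = "x @ [A, B] @ y @ [A, B] @ z"
  have "count_list ?w A = 2" "count_list ?w B = 2"
    using assms unfolding gauss_word_def by simp_all
  then have AB: "A \<noteq> B" "A \<notin> set (x @ y @ z)" "B \<notin> set (x @ y @ z)"
    by (auto simp: count_list_0_iff[symmetric] split: if_splits)
  moreover have "count_list (x @ y @ z) a = 0 \<or> count_list (x @ y @ z) a = 2" for a
    using assms[unfolded gauss_word_iff, rule_format, of a] AB
    by (cases "a \<in> {A, B}") (auto simp: count_list_0_iff)
  ultimately show ?thesis
    by (simp add: gauss_word_iff)
qed

lemma homotopic_H1: "gauss_word (x @ [A, A] @ y) \<Longrightarrow> gauss_word (x @ y) \<Longrightarrow>
    homotopic (x @ [A, A] @ y) (x @ y)"
  by (intro homotopic.move H1)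

lemma homotopic_H2: "gauss_word (x @ [A, B] @ y @ [B, A] @ z) \<Longrightarrow> gauss_word (x @ y @ z) \<Longrightarrow>
    homotopic (x @ [A, B] @ y @ [B, A] @ z) (x @ y @ z)"
  by (intro homotopic.move H2)

lemma homotopic_H3: "gauss_word (x @ [A, B] @ y @ [A, C] @ z @ [B, C] @ t) \<Longrightarrow>
    gauss_word (x @ [B, A] @ y @ [C, A] @ z @ [C, B] @ t) \<Longrightarrow>
    homotopic (x @ [A, B] @ y @ [A, C] @ z @ [B, C] @ t) (x @ [B, A] @ y @ [C, A] @ z @ [C, B] @ t)"
  by (intro homotopic.move H3)

text \<open>The move H2 with parallel instead of antiparallel pairs, and H3 with one of the outer pairs
  reversed, are consequences of H1, H2 and H3 in the presence of auxiliary letters.\<close>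

lemma homotopic_H2_parallel:
  fixes A B :: "'a::infinite"
  assumes "gauss_word (x @ [A, B] @ y @ [A, B] @ z)"
  shows "homotopic (x @ [A, B] @ y @ [A, B] @ z) (x @ y @ z)"
proof -
  let ?F = "insert A (insert B (set (x @ y @ z)))"
  obtain P where P: "P \<notin> ?F"
    by (rule fresh_letter[of ?F]) simp_all
  obtain Q where Q: "Q \<notin> insert P ?F"
    by (rule fresh_letter[of "insert P ?F"]) simp_all
  obtain R where R: "R \<notin> insert Q (insert P ?F)"
    by (rule fresh_letter[of "insert Q (insert P ?F)"]) simp_all
  obtain S where S: "S \<notin> insert R (insert Q (insert P ?F))"
    by (rule fresh_letter[of "insert R (insert Q (insert P ?F))"]) simp_all
  have AB: "A \<noteq> B" "A \<notin> set (x @ y @ z)" "B \<notin> set (x @ y @ z)" and v: "gauss_word (x @ y @ z)"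
    using gauss_word_parallel_pairs[OF assms] by auto
  have count0: "count_list x a = 0" "count_list y a = 0" "count_list z a = 0" if "a \<in> {A, B, P, Q, R, S}" for a
    using that AB P Q R S by (auto simp: count_list_0_iff)
  note gauss = gauss_word_transfer[OF v, of "{A, B, P, Q, R, S}"]
  have distinct: "distinct [A, B, P, Q, R, S]"
    using AB P Q R S by auto
  note [simp] = count0
  \<comment> \<open>With \<open>s1\<close>, \<open>s2\<close>, \<open>s3\<close> read backwards, the
    chain is \<open>x AB y AB z\<close>, \<open>x PQABQP y AB z\<close>,
    \<open>x PRSQABQP y ABSR z\<close>, \<open>x PRQSAQBP y ASBR z\<close>,
    \<open>x PRQQBP y BR z\<close>, \<open>x PRBP y BR z\<close>, \<open>x PP y z\<close>,
    \<open>x y z\<close>. The H3 move \<open>s3\<close> makes \<open>A\<close> a neighbour of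
    \<open>S\<close> in opposite orders, so that \<open>A\<close> leaves with \<open>S\<close>; then
    \<open>Q\<close> leaves alone, and \<open>B\<close> leaves with \<open>R\<close>.\<close>
  have s1: "homotopic (x @ [P, Q] @ [A, B] @ [Q, P] @ y @ [A, B] @ z) (x @ [A, B] @ y @ [A, B] @ z)"
    by (rule homotopic_H2[where y="[A, B]" and z="y @ [A, B] @ z"]; rule gauss; use distinct in auto)
  have s2: "homotopic ((x @ [P]) @ [R, S] @ ([Q, A, B, Q, P] @ y @ [A, B]) @ [S, R] @ z)
      ((x @ [P]) @ ([Q, A, B, Q, P] @ y @ [A, B]) @ z)"
    by (rule homotopic_H2; rule gauss; use distinct in auto)
  have s3: "homotopic ((x @ [P, R]) @ [Q, S] @ [A] @ [Q, B] @ ([P] @ y @ [A]) @ [S, B] @ ([R] @ z))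
      ((x @ [P, R]) @ [S, Q] @ [A] @ [B, Q] @ ([P] @ y @ [A]) @ [B, S] @ ([R] @ z))"
    by (rule homotopic_H3; rule gauss; use distinct in auto)
  have s4: "homotopic ((x @ [P, R, Q]) @ [S, A] @ ([Q, B, P] @ y) @ [A, S] @ ([B, R] @ z))
      ((x @ [P, R, Q]) @ ([Q, B, P] @ y) @ ([B, R] @ z))"
    by (rule homotopic_H2; rule gauss; use distinct in auto)
  have s5: "homotopic ((x @ [P, R]) @ [Q, Q] @ ([B, P] @ y @ [B, R] @ z)) ((x @ [P, R]) @ ([B, P] @ y @ [B, R] @ z))"
    by (rule homotopic_H1; rule gauss; use distinct in auto)
  have s6: "homotopic ((x @ [P]) @ [R, B] @ ([P] @ y) @ [B, R] @ z) ((x @ [P]) @ ([P] @ y) @ z)"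
    by (rule homotopic_H2; rule gauss; use distinct in auto)
  have s7: "homotopic (x @ [P, P] @ (y @ z)) (x @ (y @ z))"
    by (rule homotopic_H1; rule gauss; use distinct in auto)
  show ?thesis
    using homotopic.trans[OF homotopic.sym[OF s1[simplified]] homotopic.trans[OF homotopic.sym[OF s2[simplified]] homotopic.trans[OF homotopic.sym[OF s3[simplified]] homotopic.trans[OF s4[simplified] homotopic.trans[OF s5[simplified] homotopic.trans[OF s6[simplified] s7[simplified]]]]]]] by simp
qed

text \<open>Compared with H3 the third pair is reversed. Insert a parallel pair \<open>DE\<close>;
  an H3 move on \<open>D\<close>, \<open>B\<close>, \<open>C\<close>, read backwards, puts
  \<open>D\<close> next to \<open>A\<close> in both places. Then the parallel pair \<open>AD\<close>
  leaves, and \<open>E\<close> takes the place of \<open>A\<close>.\<close>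

lemma homotopic_H3_first:
  fixes A B C :: "'a::infinite"
  assumes "gauss_word (w @ [A, B] @ x @ [A, C] @ y @ [C, B] @ z)"
  shows "homotopic (w @ [A, B] @ x @ [A, C] @ y @ [C, B] @ z) (w @ [B, A] @ x @ [C, A] @ y @ [B, C] @ z)"
proof -
  let ?v = "w @ x @ y @ z" and ?W = "w @ [A, B] @ x @ [A, C] @ y @ [C, B] @ z"
  let ?F = "insert A (insert B (insert C (set ?v)))"
  obtain D where D: "D \<notin> ?F"
    by (rule fresh_letter[of ?F]) simp_all
  obtain E where E: "E \<notin> insert D ?F"
    by (rule fresh_letter[of "insert D ?F"]) simp_all
  have "count_list ?W A = 2" "count_list ?W B = 2" "count_list ?W C = 2"
    using assms unfolding gauss_word_def by simp_all
  then have ABC: "A \<noteq> B" "A \<noteq> C" "B \<noteq> C" "A \<notin> set ?v" "B \<notin> set ?v" "C \<notin> set ?v"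
    by (auto simp: count_list_0_iff[symmetric] split: if_splits)
  have distinct: "distinct [A, B, C, D, E]"
    using ABC D E by auto
  have count0: "count_list w a = 0" "count_list x a = 0" "count_list y a = 0" "count_list z a = 0"
    if "a \<in> {A, B, C, D, E}" for a
    using that ABC D E by (auto simp: count_list_0_iff)
  note gauss = gauss_word_transfer[OF assms, of "{A, B, C, D, E}"]
  note [simp] = count0
  have s1: "homotopic ((w @ [A, B]) @ [D, E] @ (x @ [A, C]) @ [D, E] @ (y @ [C, B] @ z))
      ((w @ [A, B]) @ (x @ [A, C]) @ (y @ [C, B] @ z))"
    by (rule homotopic_H2_parallel; rule gauss; use distinct in auto)
  have s2: "homotopic ((w @ [A]) @ [D, B] @ ([E] @ x @ [A]) @ [D, C] @ ([E] @ y) @ [B, C] @ z)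
      ((w @ [A]) @ [B, D] @ ([E] @ x @ [A]) @ [C, D] @ ([E] @ y) @ [C, B] @ z)"
    by (rule homotopic_H3; rule gauss; use distinct in auto)
  have s3: "homotopic (w @ [A, D] @ ([B, E] @ x) @ [A, D] @ ([C, E] @ y @ [B, C] @ z))
      (w @ ([B, E] @ x) @ ([C, E] @ y @ [B, C] @ z))"
    by (rule homotopic_H2_parallel; rule gauss; use distinct in auto)
  have s4: "homotopic (w @ [B, E] @ x @ [C, E] @ y @ [B, C] @ z) (w @ [B, A] @ x @ [C, A] @ y @ [B, C] @ z)"
  proof (rule homotopic.iso)
    show "word_isomorphic (w @ [B, E] @ x @ [C, E] @ y @ [B, C] @ z) (w @ [B, A] @ x @ [C, A] @ y @ [B, C] @ z)"
      by (rule word_isomorphicI[where f="(\<lambda>a. a)(E := A)"])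
        (use ABC D E in \<open>auto simp: inj_on_def intro!: map_idI\<close>)
  qed (rule gauss; use distinct in auto)+
  show ?thesis
    using homotopic.trans[OF homotopic.sym[OF s1[simplified]] homotopic.trans[OF homotopic.sym[OF s2[simplified]] homotopic.trans[OF s3[simplified] s4[simplified]]]] by simp
qed

text \<open>After exchanging the names \<open>A\<close> and \<open>B\<close>, this is H3 with the
  first pair reversed. Here \<open>E\<close> enters with \<open>D\<close>, leaves with
  \<open>C\<close> after an H3 move on \<open>B\<close>, \<open>A\<close>, \<open>E\<close>, and
  \<open>D\<close> takes the place of \<open>C\<close>.\<close>

lemma homotopic_H3_last:
  fixes A B C :: "'a::infinite"
  assumes "gauss_word (w @ [A, B] @ x @ [B, C] @ y @ [A, C] @ z)"
  shows "homotopic (w @ [A, B] @ x @ [B, C] @ y @ [A, C] @ z) (w @ [B, A] @ x @ [C, B] @ y @ [C, A] @ z)"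
proof -
  let ?v = "w @ x @ y @ z" and ?W = "w @ [A, B] @ x @ [B, C] @ y @ [A, C] @ z"
  let ?F = "insert A (insert B (insert C (set ?v)))"
  obtain D where D: "D \<notin> ?F"
    by (rule fresh_letter[of ?F]) simp_all
  obtain E where E: "E \<notin> insert D ?F"
    by (rule fresh_letter[of "insert D ?F"]) simp_all
  have "count_list ?W A = 2" "count_list ?W B = 2" "count_list ?W C = 2"
    using assms unfolding gauss_word_def by simp_all
  then have ABC: "A \<noteq> B" "A \<noteq> C" "B \<noteq> C" "A \<notin> set ?v" "B \<notin> set ?v" "C \<notin> set ?v"
    by (auto simp: count_list_0_iff[symmetric] split: if_splits)
  have distinct: "distinct [A, B, C, D, E]"
    using ABC D E by auto
  have count0: "count_list w a = 0" "count_list x a = 0" "count_list y a = 0" "count_list z a = 0"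
    if "a \<in> {A, B, C, D, E}" for a
    using that ABC D E by (auto simp: count_list_0_iff)
  note gauss = gauss_word_transfer[OF assms, of "{A, B, C, D, E}"]
  note [simp] = count0
  have s1: "homotopic ((w @ [A, B] @ x) @ [D, E] @ ([B, C] @ y) @ [D, E] @ ([A, C] @ z))
      ((w @ [A, B] @ x) @ ([B, C] @ y) @ ([A, C] @ z))"
    by (rule homotopic_H2_parallel; rule gauss; use distinct in auto)
  have s2: "homotopic (w @ [B, A] @ (x @ [D]) @ [B, E] @ ([C] @ y @ [D]) @ [A, E] @ ([C] @ z))
      (w @ [A, B] @ (x @ [D]) @ [E, B] @ ([C] @ y @ [D]) @ [E, A] @ ([C] @ z))"
    by (rule homotopic_H3; rule gauss; use distinct in auto)
  have s3: "homotopic ((w @ [B, A] @ x @ [D, B]) @ [E, C] @ (y @ [D, A]) @ [E, C] @ z)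
      ((w @ [B, A] @ x @ [D, B]) @ (y @ [D, A]) @ z)"
    by (rule homotopic_H2_parallel; rule gauss; use distinct in auto)
  have s4: "homotopic (w @ [B, A] @ x @ [D, B] @ y @ [D, A] @ z) (w @ [B, A] @ x @ [C, B] @ y @ [C, A] @ z)"
  proof (rule homotopic.iso)
    show "word_isomorphic (w @ [B, A] @ x @ [D, B] @ y @ [D, A] @ z) (w @ [B, A] @ x @ [C, B] @ y @ [C, A] @ z)"
      by (rule word_isomorphicI[where f="(\<lambda>a. a)(D := C)"])
        (use ABC D E in \<open>auto simp: inj_on_def intro!: map_idI\<close>)
  qed (rule gauss; use distinct in auto)+
  show ?thesis
    using homotopic.trans[OF homotopic.sym[OF s1[simplified]] homotopic.trans[OF homotopic.sym[OF s2[simplified]] homotopic.trans[OF s3[simplified] s4[simplified]]]] by simp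
qed

subsection \<open>Reducible words\<close>

fun adjacent :: "'a \<Rightarrow> 'a \<Rightarrow> 'a list \<Rightarrow> bool" where
  "adjacent a b (c # d # w) \<longleftrightarrow> (a = c \<and> b = d \<or> a = d \<and> b = c) \<or> adjacent a b (d # w)"
| "adjacent a b w \<longleftrightarrow> False"

text \<open>Recursive rather than existential, so that irreducible words can be found by
  evaluation.\<close>

fun reducible :: "'a list \<Rightarrow> bool" where
  "reducible (a # b # w) \<longleftrightarrow> a = b \<or> adjacent a b w \<or> reducible (b # w)"
| "reducible w \<longleftrightarrow> False"

lemma adjacent_split:
  "adjacent a b w \<Longrightarrow> \<exists>y z. w = y @ [a, b] @ z \<or> w = y @ [b, a] @ z"
proof (induction a b w rule: adjacent.induct)
  case (1 a b c d w)
  show ?case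
  proof (cases "a = c \<and> b = d \<or> a = d \<and> b = c")
    case True
    then have "c # d # w = [] @ [a, b] @ w \<or> c # d # w = [] @ [b, a] @ w"
      by auto
    then show ?thesis
      by blast
  next
    case False
    then obtain y z where "d # w = y @ [a, b] @ z \<or> d # w = y @ [b, a] @ z"
      using 1 by auto
    then have "c # d # w = (c # y) @ [a, b] @ z \<or> c # d # w = (c # y) @ [b, a] @ z"
      by auto
    then show ?thesis
      by blast
  qed
qed simp_all

lemma reducible_split:
  "reducible w \<Longrightarrow> (\<exists>x a y. w = x @ [a, a] @ y) \<or> (\<exists>x a b y z. w = x @ [a, b] @ y @ [a, b] @ z)
    \<or> (\<exists>x a b y z. w = x @ [a, b] @ y @ [b, a] @ z)"
proof (induction w rule: reducible.induct)
  case (1 a b w)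
  consider "a = b" | "adjacent a b w" | "reducible (b # w)"
    using 1(2) by auto
  then show ?case
  proof cases
    case 1
    then have "a # b # w = [] @ [a, a] @ w"
      by simp
    then show ?thesis
      by (intro disjI1 exI)
  next
    case 2
    obtain y z where "w = y @ [a, b] @ z \<or> w = y @ [b, a] @ z"
      using adjacent_split[OF 2] by (elim exE)
    then show ?thesis
    proof
      assume "w = y @ [a, b] @ z"
      then have "a # b # w = [] @ [a, b] @ y @ [a, b] @ z"
        by simp
      then show ?thesis
        by (intro disjI2 disjI1 exI)
    next
      assume "w = y @ [b, a] @ z"
      then have "a # b # w = [] @ [a, b] @ y @ [b, a] @ z"
        by simp
      then show ?thesis
        by (intro disjI2 exI)
    qed
  next
    case 3
    have prefix: "a # b # w = (a # x) @ u" if "b # w = x @ u" for x u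
      using that by simp
    from 1(1)[OF 3] show ?thesis
    proof (elim disjE exE)
      fix x c y assume "b # w = x @ [c, c] @ y"
      from prefix[OF this] show ?thesis
        by (intro disjI1 exI)
    next
      fix x c d y z assume "b # w = x @ [c, d] @ y @ [c, d] @ z"
      from prefix[OF this] show ?thesis
        by (intro disjI2 disjI1 exI)
    next
      fix x c d y z assume "b # w = x @ [c, d] @ y @ [d, c] @ z"
      from prefix[OF this] show ?thesis
        by (intro disjI2 exI)
    qed
  qed
qed simp_all

lemma adjacent_map: "adjacent a b w \<Longrightarrow> adjacent (f a) (f b) (map f w)"
  by (induction a b w rule: adjacent.induct) auto

text \<open>Allows the test to be made on an enumerated representative instead of the given
  word.\<close>

lemma reducible_map: "reducible w \<Longrightarrow> reducible (map f w)"
  by (induction w rule: reducible.induct) (auto intro: adjacent_map)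

lemma reducible_homotopic_smaller_rank:
  fixes w :: "'a::infinite list"
  assumes "gauss_word w" "reducible w"
  obtains v where "gauss_word v" "gauss_rank v < gauss_rank w" "homotopic w v"
proof -
  consider (1) x a y where "w = x @ [a, a] @ y"
    | (2) x a b y z where "w = x @ [a, b] @ y @ [a, b] @ z"
    | (3) x a b y z where "w = x @ [a, b] @ y @ [b, a] @ z"
    using reducible_split[OF assms(2)] by blast
  then show thesis
  proof cases
    case (1 x a y)
    have "count_list w a = 2"
      using assms(1) 1 by (simp add: gauss_word_def)
    then have a: "a \<notin> set (x @ y)"
      using 1 by (auto simp: count_list_0_iff[symmetric])
    have g: "gauss_word (x @ y)"
      using gauss_word_transfer[OF assms(1), of "{a}"] a 1 by (auto simp: count_list_0_iff)
    have "set w = insert a (set (x @ y))"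
      using 1 by auto
    then have "gauss_rank (x @ y) < gauss_rank w"
      using a by (simp add: gauss_rank_def del: set_append)
    moreover have "homotopic w (x @ y)"
      using assms(1) g unfolding 1 by (rule homotopic_H1)
    ultimately show ?thesis
      using that g by simp
  next
    case (2 x a b y z)
    have ab: "a \<noteq> b" "a \<notin> set (x @ y @ z)" "b \<notin> set (x @ y @ z)" and g: "gauss_word (x @ y @ z)"
      using gauss_word_parallel_pairs[OF assms(1)[unfolded 2]] by simp_all
    have "set w = insert a (insert b (set (x @ y @ z)))"
      using 2 by auto
    then have "gauss_rank (x @ y @ z) < gauss_rank w"
      using ab by (simp add: gauss_rank_def del: set_append)
    moreover have "homotopic w (x @ y @ z)"
      using assms(1) unfolding 2 by (rule homotopic_H2_parallel)
    ultimately show ?thesis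
      using that g by simp
  next
    case (3 x a b y z)
    \<comment> \<open>This word has the same letters with the same multiplicities as
      \<open>w\<close>, so the facts about parallel pairs apply.\<close>
    have g': "gauss_word (x @ [a, b] @ y @ [a, b] @ z)"
      using gauss_word_transfer[OF assms(1), of "{}"] 3 by simp
    then have ab: "a \<noteq> b" "a \<notin> set (x @ y @ z)" "b \<notin> set (x @ y @ z)" and g: "gauss_word (x @ y @ z)"
      using gauss_word_parallel_pairs[OF g'] by simp_all
    have "set w = insert a (insert b (set (x @ y @ z)))"
      using 3 by auto
    then have "gauss_rank (x @ y @ z) < gauss_rank w"
      using ab by (simp add: gauss_rank_def del: set_append)
    moreover have "homotopic w (x @ y @ z)"
      using assms(1) g unfolding 3 by (rule homotopic_H2)
    ultimately show ?thesis
      using that g by simp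
  qed
qed

subsection \<open>Words of rank at most 4\<close>

text \<open>Letters are numbered by first occurrence, which gives one representative per isomorphism
  class: the first letter is 0, and its second occurrence may be inserted anywhere. There are 1, 1,
  3, 15, 105 words of rank 0 to 4.\<close>

fun gauss_words :: "nat \<Rightarrow> nat list list" where
  "gauss_words 0 = [[]]"
| "gauss_words (Suc n) = concat (map (\<lambda>u. map (\<lambda>i. 0 # take i u @ 0 # drop i u) [0..<Suc (length u)])
    (map (map Suc) (gauss_words n)))"

lemma gauss_words_complete:
  fixes w :: "'a list"
  assumes "gauss_word w"
  shows "\<exists>c f. c \<in> set (gauss_words (gauss_rank w)) \<and> inj_on f (set c) \<and> w = map f c"
  using assms
proof (induction "gauss_rank w" arbitrary: w)
  case 0
  then show ?case
    by (simp add: gauss_rank_def)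
next
  case (Suc n)
  obtain A u where w: "w = A # u"
    using Suc(2) by (cases w) (auto simp: gauss_rank_def)
  have A1: "count_list u A = 1"
    using Suc(3) by (simp add: gauss_word_def w)
  then have "A \<in> set u"
    by (metis count_notin zero_neq_one)
  then obtain y z where u: "u = y @ A # z"
    by (meson split_list)
  have A: "A \<notin> set (y @ z)"
    using A1 by (auto simp: u count_list_0_iff)
  have g: "gauss_word (y @ z)"
    using gauss_word_transfer[OF Suc(3), of "{A}" "y @ z"] A by (auto simp: w u count_list_0_iff)
  have "set w = insert A (set (y @ z))"
    by (auto simp: w u)
  then have "n = gauss_rank (y @ z)"
    using Suc(2) A by (simp add: gauss_rank_def del: set_append)
  then obtain c f where c: "c \<in> set (gauss_words n)" and f: "inj_on f (set c)" "y @ z = map f c"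
    using Suc(1) g by blast
  \<comment> \<open>\<open>?i\<close> is the place of the second \<open>A\<close> in the rest of the
    word; \<open>?f\<close> sends 0 to \<open>A\<close> and undoes the shift on the other
    letters.\<close>
  let ?c = "map Suc c" and ?f = "case_nat A f" and ?i = "length y"
  have y: "y = map f (take ?i c)" and z: "z = map f (drop ?i c)"
    using f(2) by (metis append_eq_conv_conj take_map drop_map)+
  have "?i \<le> length c"
    using arg_cong[OF f(2), of length] by simp
  then have "0 # take ?i ?c @ 0 # drop ?i ?c \<in> set (gauss_words (Suc n))"
    using c by (auto simp del: upt_Suc intro!: bexI[of _ c] imageI)
  moreover have "w = map ?f (0 # take ?i ?c @ 0 # drop ?i ?c)"
    using y z by (simp add: w u take_map drop_map comp_def)
  moreover have "inj_on ?f (set (0 # take ?i ?c @ 0 # drop ?i ?c))"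
  proof (rule inj_on_subset)
    have "f ` set c = set (y @ z)"
      unfolding f(2) by simp
    then show "inj_on ?f (insert 0 (Suc ` set c))"
      using f(1) A by (auto simp: inj_on_def image_iff)
    show "set (0 # take ?i ?c @ 0 # drop ?i ?c) \<subseteq> insert 0 (Suc ` set c)"
      using set_take_subset[of ?i ?c] set_drop_subset[of ?i ?c] by auto
  qed
  ultimately show ?case
    using Suc(2) by metis
qed


lemma irreducible_rank_le_3:
  "filter (\<lambda>c. \<not> reducible c) (concat (map gauss_words [0..<4])) = [[], [0,1,0,2,1,2]]"
  by code_simp

text \<open>Seven of these are the words that define \<open>S1\<close>, \<open>S2\<close>,
  \<open>S3\<close>; the other four are shown to be trivial in
  \<open>homotopic_Nil_rank_4\<close>.\<close>

lemma irreducible_rank_4: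
  "filter (\<lambda>c. \<not> reducible c) (gauss_words 4) =
    [[0,1,2,0,2,3,1,3], [0,1,0,2,1,3,2,3], [0,1,2,1,3,0,2,3], [0,1,2,1,3,2,0,3], [0,1,2,1,3,2,3,0],
     [0,1,0,2,3,2,1,3], [0,1,2,0,3,2,3,1], [0,1,2,3,2,0,3,1], [0,1,2,1,3,0,3,2], [0,1,2,0,3,1,3,2],
     [0,1,2,3,1,3,0,2]]"
  by code_simp

lemma homotopic_Nil_rank_le_3:
  fixes w :: "'a::infinite list"
  assumes "gauss_word w" "gauss_rank w \<le> 3"
  shows "homotopic w []"
  using assms
proof (induction "gauss_rank w" arbitrary: w rule: less_induct)
  case less
  \<comment> \<open>Stated for every word of the same rank, since it is applied to \<open>w\<close>
    and also to its image under H3.\<close>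
  have step: "homotopic v []" if v: "gauss_word v" "reducible v" "gauss_rank v = gauss_rank w" for v :: "'a list"
  proof -
    obtain u where u: "gauss_word u" "gauss_rank u < gauss_rank v" "homotopic v u"
      using reducible_homotopic_smaller_rank[OF v(1,2)] .
    then have "homotopic u []"
      using less(1,3) v(3) by simp
    with u(3) show ?thesis
      by (rule homotopic.trans)
  qed
  obtain c f where c: "c \<in> set (gauss_words (gauss_rank w))" and f: "inj_on f (set c)" and w: "w = map f c"
    using gauss_words_complete[OF less(2)] by blast
  show ?case
  proof (cases "reducible c")
    case True
    then show ?thesis
      using step[OF less(2)] reducible_map w by blast
  next
    case False
    then have "c \<in> set (filter (\<lambda>c. \<not> reducible c) (concat (map gauss_words [0..<4])))"
      using c less(3) by (auto simp del: upt_Suc intro!: bexI[of _ "gauss_rank w"])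
    then consider "c = []" | "c = [0,1,0,2,1,2]"
      unfolding irreducible_rank_le_3 by auto
    then show ?thesis
    proof cases
      case 1
      then show ?thesis
        using less(2) w by (simp add: homotopic.refl)
    next
      case 2
      \<comment> \<open>H3 with empty surroundings turns \<open>ABACBC\<close> into
        \<open>BACACB\<close>, which contains the parallel pair \<open>AC\<close>.\<close>
      let ?v = "[] @ [f 1, f 0] @ [] @ [f 2, f 0] @ [] @ [f 2, f 1] @ []"
      have v: "gauss_word ?v" "gauss_rank ?v = gauss_rank w" "reducible ?v"
        using f 2 w by (auto simp: inj_on_def gauss_word_def gauss_rank_def insert_commute)
      have "homotopic ([] @ [f 0, f 1] @ [] @ [f 0, f 2] @ [] @ [f 1, f 2] @ []) ?v"
        using less(2) v(1) 2 w by (intro homotopic_H3) simp_all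
      moreover have "homotopic ?v []"
        by (rule step) (use v in simp_all)
      ultimately show ?thesis
        using 2 w by (auto intro: homotopic.trans)
    qed
  qed
qed

lemma homotopic_Nil_reducible:
  fixes w :: "'a::infinite list"
  assumes "gauss_word w" "gauss_rank w \<le> 4" "reducible w"
  shows "homotopic w []"
proof -
  obtain v where v: "gauss_word v" "gauss_rank v < gauss_rank w" "homotopic w v"
    using reducible_homotopic_smaller_rank[OF assms(1,3)] .
  then have "homotopic v []"
    using assms(2) by (intro homotopic_Nil_rank_le_3) simp_all
  with v(3) show ?thesis
    by (rule homotopic.trans)
qed

lemma homotopic_Nil_if_homotopic_reducible:
  fixes v w :: "'a::infinite list"
  assumes "homotopic w v" "gauss_word v" "gauss_rank v \<le> 4" "reducible v"
  shows "homotopic w []"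
  using homotopic.trans[OF assms(1) homotopic_Nil_reducible[OF assms(2-4)]] .

text \<open>One move creates a parallel pair in each word: \<open>cd\<close>, \<open>bd\<close>,
  \<open>ac\<close> and \<open>ac\<close>, respectively. The last word needs the derived form
  \<open>homotopic_H3_first\<close>.\<close>

lemma homotopic_Nil_rank_4:
  fixes a b c d :: "'a::infinite"
  assumes "distinct [a, b, c, d]"
  shows "homotopic [a,b,c,b,d,c,a,d] []" "homotopic [a,b,c,b,d,c,d,a] []"
    "homotopic [a,b,c,a,d,c,d,b] []" "homotopic [a,b,c,b,d,a,d,c] []"
proof -
  show "homotopic [a,b,c,b,d,c,a,d] []"
  proof (rule homotopic_Nil_if_homotopic_reducible)
    show "homotopic [a,b,c,b,d,c,a,d] [b,a,b,c,d,a,c,d]"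
      using homotopic.sym[OF homotopic_H3[of "[]" b a "[]" c "[d]" "[d]"]] assms by (auto simp: gauss_word_def)
  qed (use assms in \<open>auto simp: gauss_word_def gauss_rank_def card_insert_if\<close>)
  show "homotopic [a,b,c,b,d,c,d,a] []"
  proof (rule homotopic_Nil_if_homotopic_reducible)
    show "homotopic [a,b,c,b,d,c,d,a] [a,c,b,d,b,d,c,a]"
      using homotopic_H3[of "[a]" b c "[]" d "[]" "[a]"] assms by (auto simp: gauss_word_def)
  qed (use assms in \<open>auto simp: gauss_word_def gauss_rank_def card_insert_if\<close>)
  show "homotopic [a,b,c,a,d,c,d,b] []"
  proof (rule homotopic_Nil_if_homotopic_reducible)
    show "homotopic [a,b,c,a,d,c,d,b] [a,c,b,a,c,d,b,d]"
      using homotopic.sym[OF homotopic_H3[of "[a]" c b "[a]" d "[]" "[]"]] assms by (auto simp: gauss_word_def)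
  qed (use assms in \<open>auto simp: gauss_word_def gauss_rank_def card_insert_if\<close>)
  show "homotopic [a,b,c,b,d,a,d,c] []"
  proof (rule homotopic_Nil_if_homotopic_reducible)
    show "homotopic [a,b,c,b,d,a,d,c] [a,c,b,d,b,a,c,d]"
      using homotopic_H3_first[of "[a]" b c "[]" d "[a]" "[]"] assms by (auto simp: gauss_word_def)
  qed (use assms in \<open>auto simp: gauss_word_def gauss_rank_def card_insert_if\<close>)
qed

section \<open>Isomorphism and representatives of the classes\<close>

lemma word_isomorphic_sym: "word_isomorphic v w \<Longrightarrow> word_isomorphic w v"
proof -
  assume "word_isomorphic v w"
  then obtain f where f: "bij_betw f (set v) (set w)" "map f v = w"
    by (auto simp: word_isomorphic_def)
  then have "map (inv_into (set v) f) w = v"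
    by (auto simp: bij_betw_def intro!: map_idI)
  then show ?thesis
    using bij_betw_inv_into[OF f(1)] unfolding word_isomorphic_def by blast
qed

lemma word_isomorphic_trans:
  assumes "word_isomorphic u v" "word_isomorphic v w"
  shows "word_isomorphic u w"
proof -
  obtain f g where f: "bij_betw f (set u) (set v)" "map f u = v" and g: "bij_betw g (set v) (set w)" "map g v = w"
    using assms by (auto simp: word_isomorphic_def)
  have "map (g \<circ> f) u = w"
    using f(2) g(2) by auto
  then show ?thesis
    using bij_betw_trans[OF f(1) g(1)] unfolding word_isomorphic_def by blast
qed

lemma word_isomorphicE:
  assumes "word_isomorphic w u"
  obtains g where "inj_on g (set u)" "w = map g u"
  using word_isomorphic_sym[OF assms] unfolding word_isomorphic_def by (metis bij_betw_def)

lemma homotopic_Nil_or_S1_S2_S3: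
  fixes w :: "'a::infinite list"
  assumes "w \<in> G4"
  shows "homotopic w [] \<or> w \<in> S1 \<union> S2 \<union> S3"
proof (cases "gauss_rank w \<le> 3 \<or> reducible w")
  case True
  then show ?thesis
    using assms homotopic_Nil_rank_le_3 homotopic_Nil_reducible by (auto simp: G4_def)
next
  case False
  then have w4: "gauss_word w" "gauss_rank w = 4" "\<not> reducible w"
    using assms by (auto simp: G4_def)
  obtain c f where c: "c \<in> set (gauss_words 4)" and f: "inj_on f (set c)" and w: "w = map f c"
    using gauss_words_complete[OF w4(1)] unfolding w4(2) by blast
  have "c \<in> set (filter (\<lambda>c. \<not> reducible c) (gauss_words 4))"
    using c w4(3) reducible_map[of c f] w by auto
  \<comment> \<open>The four trivial words stay numeric, to fit \<open>homotopic_Nil_rank_4\<close>;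
    the others are spelled with letters, to fit the definitions of \<open>S1\<close>,
    \<open>S2\<close>, \<open>S3\<close>.\<close>
  then have c: "c \<in> {[0,1,2,1,3,2,0,3], [0,1,2,1,3,2,3,0], [0,1,2,0,3,2,3,1], [0,1,2,1,3,0,3,2]} \<or>
      map ((!) ''ABCD'') c \<in> {''ABACDCBD'', ''ABCBDACD'', ''ABCDCADB'', ''ABCACDBD'', ''ABCADBDC'', ''ABCDBDAC'', ''ABACBDCD''}"
    and set_c: "set c = {0, 1, 2, 3}"
    unfolding irreducible_rank_4 list.set by (elim insertE emptyE; hypsubst; auto)+
  have distinct: "distinct [f 0, f 1, f 2, f 3]"
    using f unfolding set_c by (auto simp: inj_on_def)
  have "word_isomorphic w (map ((!) ''ABCD'') c)"
  proof (rule word_isomorphic_trans)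
    show "word_isomorphic w c"
      using f w by (auto intro: word_isomorphic_sym word_isomorphicI)
    show "word_isomorphic c (map ((!) ''ABCD'') c)"
      by (rule word_isomorphicI[OF _ HOL.refl]) (auto simp: set_c inj_on_def)
  qed
  then show ?thesis
    using c homotopic_Nil_rank_4[OF distinct] w w4(1) by (auto simp: S1_def S2_def S3_def)
qed

text \<open>Up to renaming, H3 links \<open>ABCDCADB\<close> with \<open>ABCBDACD\<close>, and
  \<open>homotopic_H3_first\<close> links the latter with \<open>ABACDCBD\<close>. Hence one
  representative suffices to evaluate the invariant on \<open>S1\<close>.\<close>

lemma S1_homotopic:
  fixes w :: "'a::infinite list"
  assumes "w \<in> S1"
  shows "\<exists>v. gauss_word v \<and> word_isomorphic v ''ABACDCBD'' \<and> homotopic w v"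
proof -
  have type2: "\<exists>v. gauss_word v \<and> word_isomorphic v ''ABACDCBD'' \<and> homotopic [a,b,c,b,d,a,c,d] v"
    if abcd: "distinct [a, b, c, d]" for a b c d :: 'a
  proof (intro exI conjI)
    show gauss: "gauss_word [b,a,b,c,d,c,a,d]"
      using abcd by (auto simp: gauss_word_def)
    show "homotopic [a,b,c,b,d,a,c,d] [b,a,b,c,d,c,a,d]"
      using homotopic.sym[OF homotopic_H3_first[of "[]" b a "[]" c "[d]" "[d]"]] gauss by simp
    show "word_isomorphic [b,a,b,c,d,c,a,d] ''ABACDCBD''"
      by (rule word_isomorphicI[where f="\<lambda>e. if e = b then CHR ''A'' else if e = a then CHR ''B'' else if e = c then CHR ''C'' else CHR ''D''"])
        (use abcd in \<open>auto simp: inj_on_def\<close>)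
  qed
  have w: "gauss_word w"
    using assms by (simp add: S1_def)
  consider "word_isomorphic w ''ABACDCBD''" | "word_isomorphic w ''ABCBDACD''" | "word_isomorphic w ''ABCDCADB''"
    using assms by (auto simp: S1_def)
  then show ?thesis
  proof cases
    case 1
    then show ?thesis
      using w homotopic.refl by blast
  next
    case 2
    then obtain g where "inj_on g (set ''ABCBDACD'')" "w = map g ''ABCBDACD''"
      by (rule word_isomorphicE)
    then show ?thesis
      using type2[of "g CHR ''A''" "g CHR ''B''" "g CHR ''C''" "g CHR ''D''"] by (simp add: inj_on_def)
  next
    case 3
    then obtain g where g: "inj_on g (set ''ABCDCADB'')" "w = map g ''ABCDCADB''"
      by (rule word_isomorphicE)
    let ?a = "g CHR ''A''" and ?b = "g CHR ''B''" and ?c = "g CHR ''C''" and ?d = "g CHR ''D''"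
    have d: "distinct [?a, ?c, ?b, ?d]"
      using g by (simp add: inj_on_def)
    then have "gauss_word [?a,?c,?b,?c,?d,?a,?b,?d]"
      by (auto simp: gauss_word_def)
    then have "homotopic [?a,?c,?b,?c,?d,?a,?b,?d] w"
      using homotopic_H3[of "[?a]" ?c ?b "[]" ?d "[?a]" "[]"] w g(2) by simp
    then show ?thesis
      using type2[OF d] homotopic.trans homotopic.sym by blast
  qed
qed

text \<open>Up to renaming, H3 links \<open>ABCDBDAC\<close> with \<open>ABCADBDC\<close>, and
  \<open>homotopic_H3_last\<close> links the latter with \<open>ABCACDBD\<close>.\<close>

lemma S2_homotopic:
  fixes w :: "'a::infinite list"
  assumes "w \<in> S2"
  shows "\<exists>v. gauss_word v \<and> word_isomorphic v ''ABCACDBD'' \<and> homotopic w v"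
proof -
  have type2: "\<exists>v. gauss_word v \<and> word_isomorphic v ''ABCACDBD'' \<and> homotopic [a,b,c,a,d,b,d,c] v"
    if abcd: "distinct [a, b, c, d]" for a b c d :: 'a
  proof (intro exI conjI)
    show gauss: "gauss_word [a,c,b,a,b,d,c,d]"
      using abcd by (auto simp: gauss_word_def)
    show "homotopic [a,b,c,a,d,b,d,c] [a,c,b,a,b,d,c,d]"
      using homotopic.sym[OF homotopic_H3_last[of "[a]" c b "[a]" d "[]" "[]"]] gauss by simp
    show "word_isomorphic [a,c,b,a,b,d,c,d] ''ABCACDBD''"
      by (rule word_isomorphicI[where f="\<lambda>e. if e = a then CHR ''A'' else if e = c then CHR ''B'' else if e = b then CHR ''C'' else CHR ''D''"])
        (use abcd in \<open>auto simp: inj_on_def\<close>)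
  qed
  have w: "gauss_word w"
    using assms by (simp add: S2_def)
  consider "word_isomorphic w ''ABCACDBD''" | "word_isomorphic w ''ABCADBDC''" | "word_isomorphic w ''ABCDBDAC''"
    using assms by (auto simp: S2_def)
  then show ?thesis
  proof cases
    case 1
    then show ?thesis
      using w homotopic.refl by blast
  next
    case 2
    then obtain g where "inj_on g (set ''ABCADBDC'')" "w = map g ''ABCADBDC''"
      by (rule word_isomorphicE)
    then show ?thesis
      using type2[of "g CHR ''A''" "g CHR ''B''" "g CHR ''C''" "g CHR ''D''"] by (simp add: inj_on_def)
  next
    case 3
    then obtain g where g: "inj_on g (set ''ABCDBDAC'')" "w = map g ''ABCDBDAC''"
      by (rule word_isomorphicE)
    let ?a = "g CHR ''A''" and ?b = "g CHR ''B''" and ?c = "g CHR ''C''" and ?d = "g CHR ''D''"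
    have d: "distinct [?b, ?a, ?c, ?d]"
      using g by (simp add: inj_on_def)
    then have "gauss_word [?b,?a,?c,?b,?d,?a,?d,?c]"
      by (auto simp: gauss_word_def)
    then have "homotopic [?b,?a,?c,?b,?d,?a,?d,?c] w"
      using homotopic_H3[of "[]" ?b ?a "[?c]" ?d "[]" "[?c]"] w g(2) by simp
    then show ?thesis
      using type2[OF d] homotopic.trans homotopic.sym by blast
  qed
qed

lemma homotopic_if_isomorphic:
  assumes "gauss_word v" "gauss_word w" "word_isomorphic v u" "word_isomorphic w u"
  shows "homotopic v w"
  using assms by (intro homotopic.iso) (blast intro: word_isomorphic_trans word_isomorphic_sym)+

subsection \<open>The four classes\<close>

text \<open>An executable form: the distinct letters are listed once, so their subsequences run
  through each set of letters exactly once.\<close>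

lemma pattern_count_subseqs:
  "pattern_count P w =
    (\<Sum>T\<leftarrow>subseqs (remdups w). occurs P (odd_letter w) (filter (\<lambda>a. a \<in> set T) w))"
proof -
  have "Pow (set w) = set (map set (subseqs (remdups w)))"
    using subseqs_powset[of "remdups w"] by simp
  then show ?thesis
    unfolding pattern_count_def
    by (simp add: sum.distinct_set_conv_list distinct_set_subseqs del: set_map) (simp add: comp_def)
qed
lemma word_invariant_Nil: "word_invariant [] = (0, 0)"
  by (simp add: word_invariant_def pattern_count_subseqs occurs_def labelled_pattern_def
    nested_pattern_def triple_patterns_def)

lemma word_invariant_ABACDCBD: "word_invariant ''ABACDCBD'' = (1, 0)"
  unfolding word_invariant_def pattern_count_subseqs by code_simp

lemma word_invariant_ABCACDBD: "word_invariant ''ABCACDBD'' = (1, 1)"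
  unfolding word_invariant_def pattern_count_subseqs by code_simp

lemma word_invariant_ABACBDCD: "word_invariant ''ABACBDCD'' = (0, 1)"
  unfolding word_invariant_def pattern_count_subseqs by code_simp

lemma word_invariant_S1: "w \<in> S1 \<Longrightarrow> word_invariant (w :: 'a::infinite list) = (1, 0)"
  by (auto dest!: S1_homotopic word_invariant_homotopic word_invariant_isomorphic simp: word_invariant_ABACDCBD)

lemma word_invariant_S2: "w \<in> S2 \<Longrightarrow> word_invariant (w :: 'a::infinite list) = (1, 1)"
  by (auto dest!: S2_homotopic word_invariant_homotopic word_invariant_isomorphic simp: word_invariant_ABCACDBD)

lemma word_invariant_S3: "w \<in> S3 \<Longrightarrow> word_invariant w = (0, 1)"
  using word_invariant_isomorphic[of w "''ABACBDCD''"] word_invariant_ABACBDCD by (simp add: S3_def)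

lemma S_subset_G4: "S1 \<union> S2 \<union> S3 \<subseteq> G4"
proof -
  have "gauss_rank w = gauss_rank u" if "word_isomorphic w u" for w :: "'a list" and u :: string
    using that by (auto simp: word_isomorphic_def gauss_rank_def bij_betw_same_card)
  then show ?thesis
    by (auto simp: S1_def S2_def S3_def G4_def gauss_rank_def card_insert_if)
qed

text \<open>A word of \<open>G4\<close> outside \<open>S1\<close>, \<open>S2\<close>,
  \<open>S3\<close> is homotopic to the empty word and so has value (0, 0), while those three sets
  have three other values. Disjointness of the four sets follows as well.\<close>

lemma S_eq_word_invariant:
  "S1 = {w :: 'a::infinite list. w \<in> G4 \<and> word_invariant w = (1, 0)}"
  "S2 = {w :: 'a::infinite list. w \<in> G4 \<and> word_invariant w = (1, 1)}"
  "S3 = {w :: 'a::infinite list. w \<in> G4 \<and> word_invariant w = (0, 1)}"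
  "S4 = {w :: 'a::infinite list. w \<in> G4 \<and> word_invariant w = (0, 0)}"
proof -
  have member: "(w \<in> S1 \<longleftrightarrow> word_invariant w = (1, 0)) \<and> (w \<in> S2 \<longleftrightarrow> word_invariant w = (1, 1)) \<and>
      (w \<in> S3 \<longleftrightarrow> word_invariant w = (0, 1)) \<and> (w \<in> S4 \<longleftrightarrow> word_invariant w = (0, 0))"
    if "w \<in> G4" for w :: "'a list"
  proof -
    have "w \<in> S1 \<union> S2 \<union> S3 \<or> word_invariant w = (0, 0)"
      using homotopic_Nil_or_S1_S2_S3[OF that] word_invariant_homotopic[of w "[]"] word_invariant_Nil by metis
    then show ?thesis
      using that word_invariant_S1[of w] word_invariant_S2[of w] word_invariant_S3[of w]
      unfolding S4_def by auto
  qed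
  show
    "S1 = {w :: 'a list. w \<in> G4 \<and> word_invariant w = (1, 0)}"
    "S2 = {w :: 'a list. w \<in> G4 \<and> word_invariant w = (1, 1)}"
    "S3 = {w :: 'a list. w \<in> G4 \<and> word_invariant w = (0, 1)}"
    using S_subset_G4 member by blast+
  show "S4 = {w :: 'a list. w \<in> G4 \<and> word_invariant w = (0, 0)}"
    using member by (auto simp: S4_def)
qed

lemma homotopic_iff_word_invariant:
  fixes v w :: "'a::infinite list"
  assumes "v \<in> G4" "w \<in> G4"
  shows "homotopic v w \<longleftrightarrow> word_invariant v = word_invariant w"
proof
  assume eq: "word_invariant v = word_invariant w"
  have S4: "homotopic u []" if "u \<in> S4" for u :: "'a list"
    using that homotopic_Nil_or_S1_S2_S3 by (auto simp: S4_def)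
  have "v \<in> S1 \<or> v \<in> S2 \<or> v \<in> S3 \<or> v \<in> S4"
    using assms(1) by (auto simp: S4_def)
  then consider "v \<in> S1" "w \<in> S1" | "v \<in> S2" "w \<in> S2" | "v \<in> S3" "w \<in> S3" | "v \<in> S4" "w \<in> S4"
    using assms(2) eq unfolding S_eq_word_invariant by auto
  then show "homotopic v w"
  proof cases
    case 1
    show ?thesis
      using S1_homotopic[OF 1(1)] S1_homotopic[OF 1(2)]
      by (meson homotopic_if_isomorphic homotopic.trans homotopic.sym)
  next
    case 2
    show ?thesis
      using S2_homotopic[OF 2(1)] S2_homotopic[OF 2(2)]
      by (meson homotopic_if_isomorphic homotopic.trans homotopic.sym)
  next
    case 3
    then show ?thesis
      by (auto simp: S3_def intro: homotopic_if_isomorphic)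
  next
    case 4
    then show ?thesis
      using S4 homotopic.trans homotopic.sym by blast
  qed
qed (rule word_invariant_homotopic)

text \<open>A quotient has no empty class, and disjoint sets are distinct once they are
  nonempty.\<close>

lemma S_nonempty: "S1 \<noteq> ({} :: 'a::infinite list set)" "S2 \<noteq> ({} :: 'a list set)"
  "S3 \<noteq> ({} :: 'a list set)" "S4 \<noteq> ({} :: 'a list set)"
proof -
  obtain h :: "nat \<Rightarrow> 'a" where h: "inj h"
    using infinite_countable_subset[OF infinite_UNIV] by blast
  \<comment> \<open>An injection of characters into the infinite alphabet turns the literals into
    words over that alphabet.\<close>
  define g where "g = h \<circ> (of_char :: char \<Rightarrow> nat)"
  have g: "g c = g d \<longleftrightarrow> c = d" for c d
    using h by (simp add: g_def inj_eq)
  have iso: "word_isomorphic (map g u) u" for u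
    by (rule word_isomorphic_sym, rule word_isomorphicI[of g]) (simp_all add: inj_on_def g)
  have "map g ''ABACDCBD'' \<in> S1" "map g ''ABCACDBD'' \<in> S2" "map g ''ABACBDCD'' \<in> S3"
    using iso[of "''ABACDCBD''"] iso[of "''ABCACDBD''"] iso[of "''ABACBDCD''"]
    by (simp_all add: S1_def S2_def S3_def gauss_word_def g)
  moreover have "([] :: 'a list) \<in> S4"
    unfolding S_eq_word_invariant by (simp add: word_invariant_Nil G4_def gauss_word_def gauss_rank_def)
  ultimately show "S1 \<noteq> ({} :: 'a list set)" "S2 \<noteq> ({} :: 'a list set)"
      "S3 \<noteq> ({} :: 'a list set)" "S4 \<noteq> ({} :: 'a list set)"
    by blast+
qed

theorem theorem5p2:
  shows "(\<forall>v w :: 'a::infinite list.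
      gauss_word v \<and> gauss_word w \<and> gauss_rank v \<le> 4 \<and> gauss_rank w \<le> 4 \<longrightarrow>
      (homotopic v w \<longleftrightarrow> (\<exists>S \<in> {S1, S2, S3, S4}. v \<in> S \<and> w \<in> S)))
    \<and> G4 // {(v, w :: 'a list). v \<in> G4 \<and> w \<in> G4 \<and> homotopic v w} = {S1, S2, S3, S4}
    \<and> card {S1, S2, S3, S4 :: 'a list set} = 4"
proof (intro conjI allI impI)
  let ?C = "{S1, S2, S3, S4 :: 'a list set}"
  let ?r = "{(v, w :: 'a list). v \<in> G4 \<and> w \<in> G4 \<and> homotopic v w}"
  have cover: "\<exists>S\<in>?C. w \<in> S" if "w \<in> G4" for w :: "'a list"
    using that by (auto simp: S4_def)
  \<comment> \<open>Each of the four sets is the homotopy class within \<open>G4\<close> of any of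
    its members; the first claim and the quotient both follow from this.\<close>
  have same: "v \<in> S \<longleftrightarrow> homotopic v w" if "S \<in> ?C" "w \<in> S" "v \<in> G4" for v w :: "'a list" and S
    using that homotopic_iff_word_invariant[of v w] by (auto simp: S_eq_word_invariant)
  have sub: "S \<subseteq> G4" if "S \<in> ?C" for S
    using that by (auto simp: S_eq_word_invariant)
  {
    fix v w :: "'a list"
    assume "gauss_word v \<and> gauss_word w \<and> gauss_rank v \<le> 4 \<and> gauss_rank w \<le> 4"
    then have "v \<in> G4" "w \<in> G4"
      by (auto simp: G4_def)
    then show "homotopic v w \<longleftrightarrow> (\<exists>S \<in> ?C. v \<in> S \<and> w \<in> S)"
      using cover[of w] same by blast
  }
  have image: "?r `` {w} = S" if "S \<in> ?C" "w \<in> S" for w S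
    using sub[OF that(1)] same[OF that] that(2) homotopic.sym by blast
  show "G4 // ?r = ?C"
  proof (intro equalityI subsetI)
    fix X
    assume "X \<in> G4 // ?r"
    then obtain w where w: "w \<in> G4" "X = ?r `` {w}"
      by (rule quotientE)
    obtain S where "S \<in> ?C" "w \<in> S"
      using cover[OF w(1)] ..
    then show "X \<in> ?C"
      using image w(2) by simp
  next
    fix S
    assume S: "S \<in> ?C"
    then obtain w where w: "w \<in> S"
      using S_nonempty by blast
    then have "w \<in> G4"
      using sub[OF S] by blast
    then show "S \<in> G4 // ?r"
      unfolding image[OF S w, symmetric] by (rule quotientI)
  qed
  have disjoint: "S1 \<inter> S2 = ({} :: 'a list set)" "S1 \<inter> S3 = ({} :: 'a list set)" "S1 \<inter> S4 = ({} :: 'a list set)"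
    "S2 \<inter> S3 = ({} :: 'a list set)" "S2 \<inter> S4 = ({} :: 'a list set)" "S3 \<inter> S4 = ({} :: 'a list set)"
    by (auto simp: S_eq_word_invariant)
  have neq: "X \<noteq> Y" if "X \<inter> Y = {}" "X \<noteq> {}" for X Y :: "'a list set"
    using that by auto
  show "card ?C = 4"
    using neq[OF disjoint(1) S_nonempty(1)] neq[OF disjoint(2) S_nonempty(1)] neq[OF disjoint(3) S_nonempty(1)]
      neq[OF disjoint(4) S_nonempty(2)] neq[OF disjoint(5) S_nonempty(2)] neq[OF disjoint(6) S_nonempty(3)]
    by simp
qed

end
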